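(* For every $n\ge 1$, the $\mathbb{Q}$-algebra $\sum_W(A_n)$ is semi-simple.
   Context: Let $e_1,\dots,e_{n+1}$ be an orthonormal basis of a Euclidean space of dimension $n+1$. The root system of type $A_n$ is $\Phi=\{e_i-e_j\mid i\ne j,\ 1\le i,j\le n+1\}$ with fundamental system $\Pi=\{e_1-e_2,\dots,e_n-e_{n+1}\}$ and corresponding positive system $\Phi^+$; $W=W(A_n)$ is the group generated by the reflections $w_r$, $r\in\Phi$. For $J\subseteq\Pi$, $W_J$ is the standard parabolic subgroup generated by the $w_r$, $r\in J$, and $X_J=\{w\in W\mid w(J)\subseteq\Phi^+\}$ is the set of distinguished (minimal length) representatives of the left cosets $wW_J$ in $W$. Put $X_J^{-1}=\{w^{-1}\mid w\in X_J\}$ and $X_{JK}=X_J^{-1}\cap X_K$. Let $x_J=\sum_{d\in X_J}d\in\mathbb{Q}W$. For $J,K,L\subseteq\Pi$, $a_{JKL}$ is the number of $w\in X_{JK}$ with $w^{-1}(J)\cap K=L$. Write $J\sim K$ if $w(J)=K$ for some $w\in W$; define $x_J\sim x_K$ if and only if $J\sim K$, and let $[x_J]=\{x_K\mid K\subseteq\Pi,\ K\sim J\}$ be the equivalence class of $x_J$. The new descent algebra $\sum_W(A_n)$ is the $\mathbb{Q}$-vector space having as basis the distinct classes $[x_J]$, $J\subseteq\Pi$, with the (well-defined) bilinear multiplication $[x_J][x_K]=\sum_{L\subseteq K}a_{JKL}[x_L]$ and identity $[x_\Pi]$. *)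

theory Defs
  imports
    "HOL-Analysis.Analysis"
    "HOL-Algebra.Algebra"
    "HOL-Algebra.Algebraic_Closure_Type"
    "HOL-Library.Poly_Mapping"
begin

section \<open>Semi-simple algebras\<close>

text \<open>
  The library locale \<open>algebra\<close> only covers commutative algebras. Here an algebra over \<open>K\<close> is
  associative and unital, but not assumed to be commutative. (\<open>Module.module\<close> is the
  carrier-based notion, as opposed to \<open>Modules.module\<close>.)
\<close>

definition assoc_algebra :: "('k, 'm) ring_scheme \<Rightarrow> ('k, 'b, 'l) module_scheme \<Rightarrow> bool" where
  "assoc_algebra K A \<longleftrightarrow>
     Module.module K A \<and> Ring.ring A \<and>
     (\<forall>q\<in>carrier K. \<forall>x\<in>carrier A. \<forall>y\<in>carrier A.
        (q \<odot>\<^bsub>A\<^esub> x) \<otimes>\<^bsub>A\<^esub> y = q \<odot>\<^bsub>A\<^esub> (x \<otimes>\<^bsub>A\<^esub> y) \<and>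
        x \<otimes>\<^bsub>A\<^esub> (q \<odot>\<^bsub>A\<^esub> y) = q \<odot>\<^bsub>A\<^esub> (x \<otimes>\<^bsub>A\<^esub> y))"

definition left_ideal :: "('k, 'm) ring_scheme \<Rightarrow> ('k, 'b, 'l) module_scheme \<Rightarrow> 'b set \<Rightarrow> bool" where
  "left_ideal K A I \<longleftrightarrow>
     submodule I K A \<and> (\<forall>a\<in>carrier A. \<forall>x\<in>I. a \<otimes>\<^bsub>A\<^esub> x \<in> I)"

text \<open>The left ideals of \<open>A\<close> which are simple as left \<open>A\<close>-modules.\<close>

definition simple_left_ideal ::
    "('k, 'm) ring_scheme \<Rightarrow> ('k, 'b, 'l) module_scheme \<Rightarrow> 'b set \<Rightarrow> bool" where
  "simple_left_ideal K A I \<longleftrightarrow>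
     left_ideal K A I \<and> I \<noteq> {\<zero>\<^bsub>A\<^esub>} \<and>
     (\<forall>I'. left_ideal K A I' \<and> I' \<subseteq> I \<longrightarrow> I' = {\<zero>\<^bsub>A\<^esub>} \<or> I' = I)"

text \<open>
  \<open>A\<close> is semi-simple if its left regular module is an internal direct sum of simple submodules.
  Since \<open>A\<close> is unital, such a direct sum can only have finitely many summands.
\<close>

definition semisimple_algebra :: "('k, 'm) ring_scheme \<Rightarrow> ('k, 'b, 'l) module_scheme \<Rightarrow> bool" where
  "semisimple_algebra K A \<longleftrightarrow>
     Ring.field K \<and> assoc_algebra K A \<and>
     (\<exists>\<I>. finite \<I> \<and> (\<forall>I\<in>\<I>. simple_left_ideal K A I) \<and>
          (\<forall>x\<in>carrier A. \<exists>!f. f \<in> (\<Pi>\<^sub>E I\<in>\<I>. I) \<and> x = (\<Oplus>\<^bsub>A\<^esub>I\<in>\<I>. f I)))"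


section \<open>Reflection groups\<close>

text \<open>
  Below, \<open>\<Phi>\<close> is a root system and \<open>\<Delta>\<close> a fundamental system in it; the symbol \<open>\<Pi>\<close> usually
  used for the latter is reserved by the library.
\<close>

definition root_reflection :: "'a::real_inner \<Rightarrow> 'a \<Rightarrow> 'a" where
  "root_reflection r v = v - (2 * (v \<bullet> r) / (r \<bullet> r)) *\<^sub>R r"

definition refl_group :: "'a::real_inner set \<Rightarrow> ('a \<Rightarrow> 'a) set" where
  "refl_group \<Phi> = generate (BijGroup UNIV) (root_reflection ` \<Phi>)"

definition pos_roots :: "'a::real_inner set \<Rightarrow> 'a set \<Rightarrow> 'a set" where
  "pos_roots \<Phi> \<Delta> = {r \<in> \<Phi>. \<exists>c. (\<forall>p\<in>\<Delta>. 0 \<le> c p) \<and> r = (\<Sum>p\<in>\<Delta>. c p *\<^sub>R p)}"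

definition X_set :: "'a::real_inner set \<Rightarrow> 'a set \<Rightarrow> 'a set \<Rightarrow> ('a \<Rightarrow> 'a) set" where
  "X_set \<Phi> \<Delta> J = {w \<in> refl_group \<Phi>. w ` J \<subseteq> pos_roots \<Phi> \<Delta>}"

definition X2_set :: "'a::real_inner set \<Rightarrow> 'a set \<Rightarrow> 'a set \<Rightarrow> 'a set \<Rightarrow> ('a \<Rightarrow> 'a) set" where
  "X2_set \<Phi> \<Delta> J K = inv_into UNIV ` X_set \<Phi> \<Delta> J \<inter> X_set \<Phi> \<Delta> K"

definition a_coeff :: "'a::real_inner set \<Rightarrow> 'a set \<Rightarrow> 'a set \<Rightarrow> 'a set \<Rightarrow> 'a set \<Rightarrow> nat" where
  "a_coeff \<Phi> \<Delta> J K L = card {w \<in> X2_set \<Phi> \<Delta> J K. inv_into UNIV w ` J \<inter> K = L}"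

definition W_equiv :: "'a::real_inner set \<Rightarrow> 'a set \<Rightarrow> 'a set \<Rightarrow> bool" where
  "W_equiv \<Phi> J K \<longleftrightarrow> (\<exists>w\<in>refl_group \<Phi>. w ` J = K)"


section \<open>The new descent algebra\<close>

text \<open>
  The rational vector space with basis \<open>B\<close> is represented by the finitely supported functions
  \<open>f :: 'b \<Rightarrow>\<^sub>0 rat\<close> with \<open>keys f \<subseteq> B\<close>; the basis vector belonging to \<open>b\<close> is \<open>single b 1\<close>.
  This is used twice: for the group algebra, of which only the vector space structure matters
  here, and for the new descent algebra itself.
\<close>

definition x_elem :: "'a::real_inner set \<Rightarrow> 'a set \<Rightarrow> 'a set \<Rightarrow> ('a \<Rightarrow> 'a) \<Rightarrow>\<^sub>0 rat" where
  "x_elem \<Phi> \<Delta> J = (\<Sum>d\<in>X_set \<Phi> \<Delta> J. Poly_Mapping.single d 1)"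

definition x_class :: "'a::real_inner set \<Rightarrow> 'a set \<Rightarrow> 'a set \<Rightarrow> (('a \<Rightarrow> 'a) \<Rightarrow>\<^sub>0 rat) set" where
  "x_class \<Phi> \<Delta> J = {x_elem \<Phi> \<Delta> K | K. K \<subseteq> \<Delta> \<and> W_equiv \<Phi> K J}"

type_synonym 'a descent_elem = "(('a \<Rightarrow> 'a) \<Rightarrow>\<^sub>0 rat) set \<Rightarrow>\<^sub>0 rat"

definition x_basis :: "'a::real_inner set \<Rightarrow> 'a set \<Rightarrow> 'a set \<Rightarrow> 'a descent_elem" where
  "x_basis \<Phi> \<Delta> J = Poly_Mapping.single (x_class \<Phi> \<Delta> J) 1"

definition rat_scale :: "rat \<Rightarrow> ('b \<Rightarrow>\<^sub>0 rat) \<Rightarrow> ('b \<Rightarrow>\<^sub>0 rat)" where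
  "rat_scale q = Poly_Mapping.map ((*) q)"

text \<open>
  The product of two basis classes \<open>C\<close> and \<open>D\<close>. The description operator encodes that it must
  not depend on the representatives \<open>J\<close> and \<open>K\<close>.
\<close>

definition class_mult :: "'a::real_inner set \<Rightarrow> 'a set \<Rightarrow>
    (('a \<Rightarrow> 'a) \<Rightarrow>\<^sub>0 rat) set \<Rightarrow> (('a \<Rightarrow> 'a) \<Rightarrow>\<^sub>0 rat) set \<Rightarrow> 'a descent_elem" where
  "class_mult \<Phi> \<Delta> C D = (THE z. \<forall>J K. J \<subseteq> \<Delta> \<and> K \<subseteq> \<Delta> \<and> x_class \<Phi> \<Delta> J = C \<and> x_class \<Phi> \<Delta> K = D \<longrightarrow>
     z = (\<Sum>L\<in>Pow K. rat_scale (of_nat (a_coeff \<Phi> \<Delta> J K L)) (x_basis \<Phi> \<Delta> L)))"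

definition descent_mult :: "'a::real_inner set \<Rightarrow> 'a set \<Rightarrow>
    'a descent_elem \<Rightarrow> 'a descent_elem \<Rightarrow> 'a descent_elem" where
  "descent_mult \<Phi> \<Delta> f g =
     (\<Sum>C\<in>Poly_Mapping.keys f. \<Sum>D\<in>Poly_Mapping.keys g.
        rat_scale (Poly_Mapping.lookup f C * Poly_Mapping.lookup g D) (class_mult \<Phi> \<Delta> C D))"

definition new_descent_algebra ::
    "'a::real_inner set \<Rightarrow> 'a set \<Rightarrow> (rat, 'a descent_elem) module" where
  "new_descent_algebra \<Phi> \<Delta> =
     \<lparr>carrier = {f. Poly_Mapping.keys f \<subseteq> x_class \<Phi> \<Delta> ` Pow \<Delta>},
      mult = descent_mult \<Phi> \<Delta>,
      one = x_basis \<Phi> \<Delta> \<Delta>,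
      ring.zero = 0,
      add = (+),
      smult = rat_scale\<rparr>"


section \<open>Type A\<close>

definition A_roots :: "nat \<Rightarrow> (nat \<Rightarrow> 'a::real_inner) \<Rightarrow> 'a set" where
  "A_roots n e = {e i - e j | i j. i \<in> {1..n+1} \<and> j \<in> {1..n+1} \<and> i \<noteq> j}"

definition A_simple :: "nat \<Rightarrow> (nat \<Rightarrow> 'a::real_inner) \<Rightarrow> 'a set" where
  "A_simple n e = {e i - e (i + 1) | i. i \<in> {1..n}}"

end

theory Submission
  imports Defs
begin

text \<open>
  The algebra is a product of copies of \<open>\<rat>\<close>, and the projections onto the factors are the
  \<^emph>\<open>marks\<close> of Burnside. For \<open>J, M \<subseteq> \<Pi>\<close> let \<open>m(M, J)\<close> be the number of cosets of \<open>W\<^sub>J\<close> that are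
  fixed by \<open>W\<^sub>M\<close>.

  For fixed \<open>M\<close> the map \<open>[x\<^sub>J] \<mapsto> m(M, J)\<close> is multiplicative: fixed points of a product of two
  \<open>W\<close>-sets are pairs of fixed points, and the \<open>W\<close>-set \<open>W/W\<^sub>J \<times> W/W\<^sub>K\<close> has one orbit for each
  \<open>d \<in> X\<^sub>J\<^sub>K\<close>, isomorphic to \<open>W/W\<^sub>L\<close> with \<open>L = d\<^sup>-\<^sup>1(J) \<inter> K\<close>. So \<open>a\<^sub>J\<^sub>K\<^sub>L\<close> counts exactly the orbits of
  type \<open>L\<close> (lemma \<open>mark_mult\<close>).

  If \<open>m(M, J) \<noteq> 0\<close>, then \<open>W\<^sub>M\<close> is conjugate to a subgroup of \<open>W\<^sub>J\<close>; hence either \<open>M\<close> has fewer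
  elements than \<open>J\<close>, or \<open>M \<sim> J\<close> (lemma \<open>mark_triangular\<close>). Indexed by conjugacy classes of
  subsets of \<open>\<Pi>\<close>, the table of marks is therefore triangular with non-zero diagonal. This has two
  consequences. The marks separate the elements of the algebra, so that the product of two
  classes does not depend on representatives, and all ring axioms are inherited from \<open>\<rat>\<close>. And
  there are elements dual to the marks, which are orthogonal idempotents; the lines spanned by them
  are simple left ideals whose direct sum is the whole algebra (lemma
  \<open>semisimple_of_dual_characters\<close>).

  In type \<open>A\<^sub>n\<close> everything becomes a statement about sorting. \<open>W\<close> permutes the \<open>n + 1\<close> positions
  \<open>0, \<dots>, n\<close>, and a subset \<open>J\<close> of \<open>\<Pi>\<close> is a set of steps from a position to the next one. Cutting
  the positions at the steps outside \<open>J\<close> yields blocks, the orbits of \<open>W\<^sub>J\<close>. Let \<open>b\<^sub>J\<close> be the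
  weakly increasing sequence of block numbers. Its rearrangements are the cosets of \<open>W\<^sub>J\<close>, and one
  of them is fixed by \<open>W\<^sub>M\<close> if and only if it is constant along the steps of \<open>M\<close>. The
  distinguished representatives are the permutations that sort these rearrangements stably. A pair
  of rearrangements of \<open>b\<^sub>J\<close> and \<open>b\<^sub>K\<close> is a single sequence of pairs; sorted lexicographically, it
  becomes \<open>(b\<^sub>K, b\<^sub>J \<circ> d)\<close> for a unique \<open>d \<in> X\<^sub>J\<^sub>K\<close>, and two neighbouring entries of this
  sequence agree exactly at the steps in \<open>d\<^sup>-\<^sup>1(J) \<inter> K\<close>.
\<close>

section \<open>Sorting finite sequences\<close>

abbreviation perms :: "nat \<Rightarrow> (nat \<Rightarrow> nat) set" where
  "perms N \<equiv> {\<pi>. \<pi> permutes {..<N}}"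

lemma perms_less: "\<pi> permutes {..<N} \<Longrightarrow> \<pi> i < N \<longleftrightarrow> i < (N::nat)"
  by (metis lessThan_iff permutes_in_image)

lemma perms_inv:
  assumes "\<pi> permutes {..<N}"
  shows "inv_into UNIV \<pi> permutes {..<N}" "\<pi> (inv_into UNIV \<pi> i) = i"
    "inv_into UNIV \<pi> (\<pi> i) = i" "\<pi> \<circ> inv_into UNIV \<pi> = id" "inv_into UNIV \<pi> \<circ> \<pi> = id"
  using assms by (auto simp: permutes_inv permutes_inverses permutes_inv_o)

text \<open>
  In terms of reflection groups: an orbit of \<open>W\<close> meets the dominant chamber in at most one point.
\<close>

lemma rearrangement_sorted_unique:
  fixes f :: "nat \<Rightarrow> nat"
  assumes \<pi>: "\<pi> permutes {..<N}"
    and f: "\<And>i. Suc i < N \<Longrightarrow> f i \<le> f (Suc i)"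
    and f\<pi>: "\<And>i. Suc i < N \<Longrightarrow> f (\<pi> i) \<le> f (\<pi> (Suc i))"
    and i: "i < N"
  shows "f (\<pi> i) = f i"
proof -
  have "mset (map (f \<circ> \<pi>) [0..<N]) = image_mset f (image_mset \<pi> (mset_set {..<N}))"
    by (simp add: mset_map image_mset.compositionality lessThan_atLeast0)
  also have "image_mset \<pi> (mset_set {..<N}) = mset_set {..<N}"
    by (metis \<pi> image_mset_mset_set permutes_image permutes_inj_on)
  also have "image_mset f \<dots> = mset (map f [0..<N])"
    by (simp add: mset_map lessThan_atLeast0)
  finally have m: "mset (map (f \<circ> \<pi>) [0..<N]) = mset (map f [0..<N])" .
  have "sorted (map f [0..<N])" "sorted (map (f \<circ> \<pi>) [0..<N])"
    using f f\<pi> by (auto simp: sorted_iff_nth_Suc)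
  then have "map (f \<circ> \<pi>) [0..<N] = map f [0..<N]"
    using m by (metis properties_for_sort)
  then show ?thesis using i by simp
qed

lemma sorting_permutation_exists:
  fixes f :: "nat \<Rightarrow> nat"
  assumes inj: "inj_on f {..<N}"
  obtains \<pi> where "\<pi> permutes {..<N}" "\<And>i. Suc i < N \<Longrightarrow> f (\<pi> i) < f (\<pi> (Suc i))"
proof -
  let ?ys = "map f [0..<N]"
  obtain \<pi> where \<pi>: "\<pi> permutes {..<length ?ys}" "permute_list \<pi> ?ys = sort ?ys"
    using mset_eq_permutation[of "sort ?ys" ?ys] by auto
  then have p: "\<pi> permutes {..<N}" by simp
  have "f (\<pi> i) < f (\<pi> (Suc i))" if i: "Suc i < N" for i
  proof -
    have nth: "sort ?ys ! k = f (\<pi> k)" if "k < N" for k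
      using that \<pi> permute_list_nth[OF \<pi>(1), of k] perms_less[OF p, of k] by simp
    have "sort ?ys ! i \<le> sort ?ys ! Suc i"
      using i sorted_nth_mono[of "sort ?ys" i "Suc i"] by simp
    moreover have "\<pi> i \<noteq> \<pi> (Suc i)"
      using permutes_inj[OF p] by (metis injD n_not_Suc_n)
    then have "f (\<pi> i) \<noteq> f (\<pi> (Suc i))"
      using inj i perms_less[OF p] by (metis Suc_lessD inj_on_def lessThan_iff)
    ultimately show ?thesis using nth i by simp
  qed
  then show ?thesis using that p by blast
qed

text \<open>
  Lexicographic comparison of pairs is encoded in a single number: the second component serves as
  a digit to base \<open>N\<close>. In this way the two preceding lemmas also apply to sequences of pairs.
\<close>

lemma digit_less_iff:
  fixes a b c d N :: nat
  assumes "b < N" "d < N"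
  shows "N * a + b < N * c + d \<longleftrightarrow> a < c \<or> a = c \<and> b < d"
proof -
  have "N * a + b < N * c + d" if "a < c" "b < N" for a b c d :: nat
  proof -
    have "N * a + b < N * Suc a" using that by simp
    also have "\<dots> \<le> N * c" using that by (intro mult_le_mono2) simp
    finally show ?thesis by simp
  qed
  then show ?thesis using assms by (metis nat_add_left_cancel_less nat_neq_iff order.asym)
qed

lemma digit_eq_iff:
  fixes a b c d N :: nat
  assumes "b < N" "d < N"
  shows "N * a + b = N * c + d \<longleftrightarrow> a = c \<and> b = d"
  using digit_less_iff[OF assms, of a c] digit_less_iff[OF assms(2,1), of c a] by fastforce

lemma digit_le_iff:
  fixes a b c d N :: nat
  assumes "b < N" "d < N"
  shows "N * a + b \<le> N * c + d \<longleftrightarrow> a < c \<or> a = c \<and> b \<le> d"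
  using digit_less_iff[OF assms] digit_eq_iff[OF assms] by (auto simp: le_less)

section \<open>Block sequences and marks\<close>

text \<open>
  The positions with a given block index form an orbit of \<open>W\<^sub>J\<close>. The stabiliser of this
  sequence in the symmetric group is \<open>W\<^sub>J\<close>, so its rearrangements represent the cosets of
  \<open>W\<^sub>J\<close>.
\<close>

primrec block_index :: "nat set \<Rightarrow> nat \<Rightarrow> nat" where
  "block_index J 0 = 0"
| "block_index J (Suc i) = block_index J i + (if i \<in> J then 0 else 1)"

definition rearrangements :: "nat \<Rightarrow> (nat \<Rightarrow> nat) \<Rightarrow> (nat \<Rightarrow> nat) set" where
  "rearrangements N f = (\<lambda>\<pi>. f \<circ> \<pi>) ` perms N"

definition const_on_steps :: "nat set \<Rightarrow> (nat \<Rightarrow> nat) \<Rightarrow> bool" where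
  "const_on_steps M h \<longleftrightarrow> (\<forall>i\<in>M. h i = h (Suc i))"

text \<open>
  For \<open>f = block_index J\<close> this is an entry of the table of marks: the number of cosets of \<open>W\<^sub>J\<close>
  which are fixed by \<open>W\<^sub>M\<close>.
\<close>

definition mark :: "nat \<Rightarrow> nat set \<Rightarrow> (nat \<Rightarrow> nat) \<Rightarrow> nat" where
  "mark N M f = card {h \<in> rearrangements N f. const_on_steps M h}"

text \<open>
  A step \<open>j\<close> stands for the simple root \<open>e\<^sub>j - e\<^sub>j\<^sub>+\<^sub>1\<close>. The condition on \<open>\<pi>\<close> says that it maps
  the simple roots in \<open>J\<close> onto those in \<open>K\<close>.
\<close>

definition step_conj :: "nat \<Rightarrow> nat set \<Rightarrow> nat set \<Rightarrow> bool" where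
  "step_conj N J K \<longleftrightarrow>
     (\<exists>\<pi>. \<pi> permutes {..<N} \<and> \<pi> ` J = K \<and> (\<forall>j\<in>J. \<pi> (Suc j) = Suc (\<pi> j)))"

text \<open>
  The set \<open>X\<^sub>J\<close>, since \<open>e\<^sub>k - e\<^sub>l\<close> is a positive root if and only if \<open>k < l\<close>.
\<close>

definition min_reps :: "nat \<Rightarrow> nat set \<Rightarrow> (nat \<Rightarrow> nat) set" where
  "min_reps N J = {\<pi>. \<pi> permutes {..<N} \<and> (\<forall>j\<in>J. \<pi> j < \<pi> (Suc j))}"

definition double_reps :: "nat \<Rightarrow> nat set \<Rightarrow> nat set \<Rightarrow> (nat \<Rightarrow> nat) set" where
  "double_reps N J K = {\<pi> \<in> min_reps N K. inv_into UNIV \<pi> \<in> min_reps N J}"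

text \<open>
  The set \<open>\<pi>\<^sup>-\<^sup>1(J) \<inter> K\<close> of simple roots, expressed by steps.
\<close>

definition meet_steps :: "nat set \<Rightarrow> nat set \<Rightarrow> (nat \<Rightarrow> nat) \<Rightarrow> nat set" where
  "meet_steps J K \<pi> = {p \<in> K. \<pi> p \<in> J \<and> \<pi> (Suc p) = Suc (\<pi> p)}"

lemma block_index_mono: "i \<le> j \<Longrightarrow> block_index J i \<le> block_index J j"
  by (rule lift_Suc_mono_le[of "block_index J"]) auto

lemma block_index_le: "block_index J i \<le> i"
  by (induction i) auto

lemma block_index_step: "i \<in> J \<Longrightarrow> block_index J (Suc i) = block_index J i" by simp

lemma block_index_eq_imp_step:
  assumes "block_index J x = block_index J y" "x \<le> i" "i < y"
  shows "i \<in> J"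
proof (rule ccontr)
  assume "i \<notin> J"
  then have "block_index J i < block_index J (Suc i)" by simp
  then show False using assms block_index_mono[of x i J] block_index_mono[of "Suc i" y J] by simp
qed

lemma const_on_block:
  assumes c: "\<And>i. \<lbrakk>i \<in> J; Suc i < N\<rbrakk> \<Longrightarrow> h i = h (Suc i)" and "block_index J x = block_index J y"
    and "x < N" "y < N"
  shows "h x = h y"
proof -
  have "h x = h y" if "x \<le> y" "block_index J x = block_index J y" "y < N" for x y
    using that
  proof (induction y rule: dec_induct)
    case base then show ?case by simp
  next
    case (step k)
    have k: "k \<in> J" using block_index_eq_imp_step[of J x "Suc k" k] step by simp
    then show ?case using step c[OF k] by simp
  qed
  then show ?thesis using assms by (metis nat_le_linear)
qed

lemma increasing_on_block:
  fixes \<tau> :: "nat \<Rightarrow> nat"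
  assumes c: "\<And>i. i \<in> J \<Longrightarrow> \<tau> i < \<tau> (Suc i)" and b: "block_index J x = block_index J y" and xy: "x < y"
  shows "\<tau> x < \<tau> y"
proof -
  have "\<tau> x < \<tau> y" if "Suc x \<le> y" "block_index J x = block_index J y"
    using that
  proof (induction y rule: dec_induct)
    case base
    have "x \<in> J" by (rule block_index_eq_imp_step[OF base]) simp_all
    then show ?case by (rule c)
  next
    case (step k)
    have k: "k \<in> J" using block_index_eq_imp_step[of J x "Suc k" k] step by simp
    then have "\<tau> x < \<tau> k" using step by simp
    also have "\<tau> k < \<tau> (Suc k)" using k by (rule c)
    finally show ?case .
  qed
  then show ?thesis using b xy by simp
qed

lemma block_index_sum: "block_index J i + card (J \<inter> {..<i}) = i"
proof (induction i)
  case (Suc i)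
  have "J \<inter> {..<Suc i} = (if i \<in> J then insert i (J \<inter> {..<i}) else J \<inter> {..<i})"
    by (auto simp: less_Suc_eq)
  then show ?case using Suc by simp
qed simp

lemma block_index_image: "block_index J ` {..i} = {..block_index J i}"
proof (induction i)
  case (Suc i)
  then show ?case by (auto simp: atMost_Suc)
qed simp

lemma card_block_index_image:
  assumes "J \<subseteq> {i. Suc i < N}" "N > 0"
  shows "card (block_index J ` {..<N}) + card J = N"
proof -
  obtain n where N: "N = Suc n" using assms by (cases N) auto
  have "J \<inter> {..<n} = J" using assms N by auto
  then show ?thesis using block_index_sum[of J n] block_index_image[of J n]
    by (simp add: N lessThan_Suc_atMost)
qed

lemma finite_perms [simp]: "finite (perms N)"
  by (simp add: finite_permutations)

lemma finite_rearrangements [simp]: "finite (rearrangements N f)"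
  by (simp add: rearrangements_def)

lemma rearrangement_comp:
  assumes "\<pi> permutes {..<N}"
  shows "rearrangements N (f \<circ> \<pi>) = rearrangements N f"
proof
  show "rearrangements N (f \<circ> \<pi>) \<subseteq> rearrangements N f"
    using assms by (auto simp: rearrangements_def comp_assoc permutes_compose)
  have f: "f \<circ> \<sigma> = (f \<circ> \<pi>) \<circ> (inv_into UNIV \<pi> \<circ> \<sigma>)" for \<sigma> :: "nat \<Rightarrow> nat"
    by (simp add: fun_eq_iff perms_inv(2)[OF assms])
  show "rearrangements N f \<subseteq> rearrangements N (f \<circ> \<pi>)"
  proof
    fix h assume "h \<in> rearrangements N f"
    then obtain \<sigma> where \<sigma>: "\<sigma> permutes {..<N}" "h = f \<circ> \<sigma>" by (auto simp: rearrangements_def)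
    then have "inv_into UNIV \<pi> \<circ> \<sigma> \<in> perms N"
      using perms_inv(1)[OF assms] by (simp add: permutes_compose)
    then show "h \<in> rearrangements N (f \<circ> \<pi>)"
      unfolding rearrangements_def using f[of \<sigma>] \<sigma>(2) by (intro image_eqI) auto
  qed
qed

lemma rearrangement_self: "f \<in> rearrangements N f"
  unfolding rearrangements_def using permutes_id by (metis comp_id image_eqI mem_Collect_eq)

text \<open>
  If the kernel of \<open>a\<close> refines that of \<open>f\<close>, then \<open>f\<close> factors through \<open>a\<close> by a surjection between
  the images. Images of equal finite size make this surjection a bijection.
\<close>

lemma factor_through:
  assumes fin: "finite A" and ker: "\<And>x y. \<lbrakk>x \<in> A; y \<in> A; a x = a y\<rbrakk> \<Longrightarrow> f x = f y"
  shows "card (f ` A) \<le> card (a ` A)"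
    and "\<lbrakk>card (a ` A) = card (f ` A); x \<in> A; y \<in> A; f x = f y\<rbrakk> \<Longrightarrow> a x = a y"
proof -
  define \<phi> where "\<phi> c = f (inv_into A a c)" for c
  have \<phi>: "\<phi> (a x) = f x" if "x \<in> A" for x
    unfolding \<phi>_def using that by (intro ker) (auto intro: inv_into_into f_inv_into_f)
  have im: "\<phi> ` (a ` A) = f ` A" by (auto simp: \<phi> image_image)
  show "card (f ` A) \<le> card (a ` A)"
    using card_image_le[of "a ` A" \<phi>] fin im by simp
  assume c: "card (a ` A) = card (f ` A)" and xy: "x \<in> A" "y \<in> A" "f x = f y"
  then have "inj_on \<phi> (a ` A)" using im fin by (intro eq_card_imp_inj_on) auto
  then show "a x = a y" using xy \<phi> by (metis imageI inj_on_def)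
qed

text \<open>
  Rearrangements of \<open>f\<close> correspond to cosets of the stabiliser of \<open>f\<close>, and this stabiliser only
  depends on the partition of the positions into the fibres of \<open>f\<close>.
\<close>

lemma mark_cong:
  assumes ker: "\<And>x y. \<lbrakk>x < N; y < N\<rbrakk> \<Longrightarrow> f x = f y \<longleftrightarrow> g x = g y"
    and M: "M \<subseteq> {i. Suc i < N}"
  shows "mark N M f = mark N M g"
proof -
  define Q where "Q = {\<pi> \<in> perms N. const_on_steps M (f \<circ> \<pi>)}"
  have less: "\<pi> i < N" if "\<pi> \<in> perms N" "i < N" for \<pi> i
    using that perms_less by auto
  have Qg: "Q = {\<pi> \<in> perms N. const_on_steps M (g \<circ> \<pi>)}"
  proof -
    have "const_on_steps M (f \<circ> \<pi>) \<longleftrightarrow> const_on_steps M (g \<circ> \<pi>)" if "\<pi> \<in> perms N" for \<pi>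
    proof -
      have "f (\<pi> i) = f (\<pi> (Suc i)) \<longleftrightarrow> g (\<pi> i) = g (\<pi> (Suc i))" if "i \<in> M" for i
        using that M \<open>\<pi> \<in> perms N\<close> ker[OF less[of \<pi> i] less[of \<pi> "Suc i"]] by auto
      then show ?thesis by (simp add: const_on_steps_def)
    qed
    then show ?thesis by (auto simp: Q_def)
  qed
  have eq: "f \<circ> \<pi> = f \<circ> \<sigma> \<longleftrightarrow> g \<circ> \<pi> = g \<circ> \<sigma>" if "\<pi> \<in> perms N" "\<sigma> \<in> perms N" for \<pi> \<sigma>
  proof -
    have "f (\<pi> i) = f (\<sigma> i) \<longleftrightarrow> g (\<pi> i) = g (\<sigma> i)" for i
    proof (cases "i < N")
      case True
      then show ?thesis using ker less that by blast
    next
      case False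
      then show ?thesis using that by (simp add: permutes_not_in)
    qed
    then show ?thesis by (simp add: fun_eq_iff)
  qed
  have "{h \<in> rearrangements N f. const_on_steps M h} = (\<lambda>\<pi>. f \<circ> \<pi>) ` Q"
    by (auto simp: rearrangements_def Q_def)
  moreover have "{h \<in> rearrangements N g. const_on_steps M h} = (\<lambda>\<pi>. g \<circ> \<pi>) ` Q"
    by (auto simp: rearrangements_def Qg)
  moreover have "finite Q" by (simp add: Q_def)
  then have "card ((\<lambda>\<pi>. f \<circ> \<pi>) ` Q) = card ((\<lambda>\<pi>. g \<circ> \<pi>) ` Q)"
  proof (intro antisym)
    show "card ((\<lambda>\<pi>. f \<circ> \<pi>) ` Q) \<le> card ((\<lambda>\<pi>. g \<circ> \<pi>) ` Q)"
      by (rule factor_through(1)[OF \<open>finite Q\<close>]) (auto simp: Q_def eq)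
    show "card ((\<lambda>\<pi>. g \<circ> \<pi>) ` Q) \<le> card ((\<lambda>\<pi>. f \<circ> \<pi>) ` Q)"
      by (rule factor_through(1)[OF \<open>finite Q\<close>]) (auto simp: Q_def eq)
  qed
  ultimately show ?thesis by (simp add: mark_def)
qed

lemma step_map_inverse:
  assumes \<pi>: "\<pi> permutes {..<N}" "\<pi> ` J = K" "\<forall>j\<in>J. \<pi> (Suc j) = Suc (\<pi> j)"
  shows "inv_into UNIV \<pi> ` K = J"
    and "\<forall>k\<in>K. inv_into UNIV \<pi> (Suc k) = Suc (inv_into UNIV \<pi> k)"
proof -
  show "inv_into UNIV \<pi> ` K = J"
    using \<pi>(2) perms_inv(3)[OF \<pi>(1)] by (auto simp: image_iff)
  show "\<forall>k\<in>K. inv_into UNIV \<pi> (Suc k) = Suc (inv_into UNIV \<pi> k)"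
    using \<pi> perms_inv(3)[OF \<pi>(1)] by (metis imageE)
qed

lemma step_conj_sym: "step_conj N J K \<Longrightarrow> step_conj N K J"
  unfolding step_conj_def by (metis step_map_inverse perms_inv(1))

lemma step_conj_ker:
  assumes "\<pi> permutes {..<N}" "\<pi> ` J = K" "\<forall>j\<in>J. \<pi> (Suc j) = Suc (\<pi> j)" "x < N" "y < N"
    and "block_index J x = block_index J y"
  shows "block_index K (\<pi> x) = block_index K (\<pi> y)"
proof (rule const_on_block[of J N "\<lambda>i. block_index K (\<pi> i)"])
  fix i assume "i \<in> J"
  then show "block_index K (\<pi> i) = block_index K (\<pi> (Suc i))" using assms(2,3) by auto
qed (use assms in auto)

lemma mark_conj:
  assumes "step_conj N J K" and M: "M \<subseteq> {i. Suc i < N}"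
  shows "mark N M (block_index J) = mark N M (block_index K)"
proof -
  obtain \<pi> where \<pi>: "\<pi> permutes {..<N}" "\<pi> ` J = K" "\<forall>j\<in>J. \<pi> (Suc j) = Suc (\<pi> j)"
    using assms by (auto simp: step_conj_def)
  let ?\<rho> = "inv_into UNIV \<pi>"
  note \<rho> = perms_inv(1)[OF \<pi>(1)] step_map_inverse[OF \<pi>]
  have "mark N M (block_index J) = mark N M (block_index K \<circ> \<pi>)"
  proof (rule mark_cong[OF _ M])
    fix x y assume xy: "x < N" "y < N"
    show "block_index J x = block_index J y \<longleftrightarrow> (block_index K \<circ> \<pi>) x = (block_index K \<circ> \<pi>) y"
      using step_conj_ker[OF \<pi> xy] step_conj_ker[OF \<rho>, of "\<pi> x" "\<pi> y"] xy
      by (auto simp: perms_less[OF \<pi>(1)] perms_inv(3)[OF \<pi>(1)])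
  qed
  then show ?thesis by (simp add: mark_def rearrangement_comp[OF \<pi>(1)])
qed

section \<open>Distinguished representatives as stable sorting permutations\<close>

lemma rearrangement_block_index_less:
  assumes "f \<in> rearrangements N (block_index J)" "i < N"
  shows "f i < N"
proof -
  obtain \<pi> where "\<pi> permutes {..<N}" "f = block_index J \<circ> \<pi>" using assms by (auto simp: rearrangements_def)
  then show ?thesis using assms(2) perms_less[of \<pi> N i] block_index_le[of J "\<pi> i"] by simp
qed

lemma sequence_strict_mono:
  fixes f :: "nat \<Rightarrow> nat"
  assumes "\<And>i. Suc i < N \<Longrightarrow> f i < f (Suc i)" "x < y" "y < N"
  shows "f x < f y"
proof -
  have "f x < f y" if "Suc x \<le> y" "y < N"
    using that
  proof (induction y rule: dec_induct)
    case base then show ?case using assms(1) by blast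
  next
    case (step k)
    then have "f x < f k" by simp
    also have "f k < f (Suc k)" using step.prems by (rule assms(1))
    finally show ?case .
  qed
  then show ?thesis using assms by simp
qed

text \<open>
  A coset of \<open>W\<^sub>J\<close> has a distinguished representative. The sequence \<open>f\<close> is sorted with ties broken
  by position, that is, by the key \<open>(f i, i)\<close>; the sorting permutation \<open>\<tau>\<close> satisfies
  \<open>f \<circ> \<tau> = block_index J\<close> and keeps the original order inside each block, which is the condition
  for being a member of \<open>X\<^sub>J\<close>. The last conclusion restates stability for \<open>\<sigma> = \<tau>\<^sup>-\<^sup>1\<close>.
\<close>

lemma stable_sort:
  assumes f: "f \<in> rearrangements N (block_index J)" and J: "J \<subseteq> {i. Suc i < N}"
  obtains \<sigma> where "\<sigma> permutes {..<N}" "f = block_index J \<circ> \<sigma>" "inv_into UNIV \<sigma> \<in> min_reps N J"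
    "\<forall>k l. k < l \<longrightarrow> l < N \<longrightarrow> f k \<le> f l \<longrightarrow> \<sigma> k < \<sigma> l"
proof -
  obtain \<pi> where \<pi>: "\<pi> permutes {..<N}" and f\<pi>: "f = block_index J \<circ> \<pi>"
    using f by (auto simp: rearrangements_def)
  define key where "key i = N * f i + i" for i
  have "inj_on key {..<N}"
    by (auto simp: inj_on_def key_def digit_eq_iff)
  then obtain \<tau> where \<tau>: "\<tau> permutes {..<N}"
      and srt: "\<And>i. Suc i < N \<Longrightarrow> key (\<tau> i) < key (\<tau> (Suc i))"
    using sorting_permutation_exists by blast
  let ?\<sigma> = "inv_into UNIV \<tau>"
  have \<sigma>: "?\<sigma> permutes {..<N}" "inv_into UNIV ?\<sigma> = \<tau>"
    using \<tau> by (auto simp: permutes_inv permutes_inv_inv)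
  have f\<tau>: "f (\<tau> i) = block_index J i" if "i < N" for i
  proof -
    have "block_index J ((\<pi> \<circ> \<tau>) i) = block_index J i"
    proof (rule rearrangement_sorted_unique[OF _ _ _ that])
      show "\<pi> \<circ> \<tau> permutes {..<N}" using \<pi> \<tau> by (simp add: permutes_compose)
      show "block_index J ((\<pi> \<circ> \<tau>) i) \<le> block_index J ((\<pi> \<circ> \<tau>) (Suc i))" if "Suc i < N" for i
        using srt[OF that] that
        by (auto simp: key_def f\<pi> digit_less_iff perms_less[OF \<tau>])
    qed auto
    then show ?thesis by (simp add: f\<pi>)
  qed
  have f\<sigma>: "f i = block_index J (?\<sigma> i)" for i
  proof (cases "i < N")
    case True
    then show ?thesis using f\<tau>[of "?\<sigma> i"] by (simp add: perms_less[OF \<sigma>(1)] perms_inv(2)[OF \<tau>])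
  next
    case False
    then show ?thesis using \<pi> \<sigma>(1) by (simp add: f\<pi> permutes_not_in)
  qed
  have mono: "?\<sigma> k < ?\<sigma> l" if "k < l" "l < N" "f k \<le> f l" for k l
  proof (rule ccontr)
    assume "\<not> ?thesis"
    moreover have "?\<sigma> k \<noteq> ?\<sigma> l" using that perms_inv(2)[OF \<tau>] by (metis less_irrefl)
    ultimately have "?\<sigma> l < ?\<sigma> k" by simp
    then have "key (\<tau> (?\<sigma> l)) < key (\<tau> (?\<sigma> k))"
      using sequence_strict_mono[of N "\<lambda>i. key (\<tau> i)"] srt that by (simp add: perms_less[OF \<sigma>(1)])
    then show False
      using that by (auto simp: perms_inv(2)[OF \<tau>] key_def digit_less_iff)
  qed
  have "\<tau> j < \<tau> (Suc j)" if j: "j \<in> J" for j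
  proof (rule ccontr)
    assume "\<not> ?thesis"
    moreover have "\<tau> j \<noteq> \<tau> (Suc j)" using permutes_inj[OF \<tau>] by (metis injD n_not_Suc_n)
    ultimately have lt: "\<tau> (Suc j) < \<tau> j" by simp
    have jN: "Suc j < N" using j J by auto
    then have "f (\<tau> (Suc j)) \<le> f (\<tau> j)" using j f\<tau>[of j] f\<tau>[of "Suc j"] by simp
    then have "?\<sigma> (\<tau> (Suc j)) < ?\<sigma> (\<tau> j)"
      using lt jN by (intro mono) (simp_all add: perms_less[OF \<tau>])
    then show False by (simp add: perms_inv(3)[OF \<tau>])
  qed
  then have "inv_into UNIV ?\<sigma> \<in> min_reps N J" using \<tau> by (simp add: \<sigma>(2) min_reps_def)
  then show ?thesis using that[of ?\<sigma>] \<sigma>(1) f\<sigma> mono by (auto simp: fun_eq_iff)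
qed

text \<open>
  A coset of \<open>W\<^sub>J\<close> has at most one distinguished representative. If \<open>\<tau>\<close> is one, the pairs
  \<open>(block_index J i, \<tau> i)\<close> increase lexicographically with \<open>i\<close>, while the set of these pairs only
  depends on the coset.
\<close>

lemma min_rep_unique:
  assumes \<sigma>: "\<sigma> permutes {..<N}" "inv_into UNIV \<sigma> \<in> min_reps N J"
    and \<rho>: "\<rho> permutes {..<N}" "inv_into UNIV \<rho> \<in> min_reps N J"
    and eq: "\<And>i. i < N \<Longrightarrow> block_index J (\<sigma> i) = block_index J (\<rho> i)"
  shows "\<sigma> = \<rho>"
proof -
  let ?s = "inv_into UNIV \<sigma>" and ?r = "inv_into UNIV \<rho>"
  note sp = perms_inv(1)[OF \<sigma>(1)] and rp = perms_inv(1)[OF \<rho>(1)]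
  define key where "key i = N * block_index J i + ?r i" for i
  have sorted: "N * block_index J i + t i \<le> N * block_index J (Suc i) + t (Suc i)"
    if "t \<in> min_reps N J" "Suc i < N" for t i
  proof -
    have "t i < N" "t (Suc i) < N" using that by (auto simp: min_reps_def perms_less)
    then show ?thesis using that by (auto simp: digit_le_iff min_reps_def)
  qed
  have key: "key ((\<rho> \<circ> ?s) i) = N * block_index J i + ?s i" if "i < N" for i
    using eq[of "?s i"] that
    by (simp add: key_def perms_less[OF sp] perms_inv(3)[OF \<rho>(1)] perms_inv(2)[OF \<sigma>(1)])
  have "?s i = ?r i" if i: "i < N" for i
  proof -
    have "key ((\<rho> \<circ> ?s) i) = key i"
    proof (rule rearrangement_sorted_unique[OF _ _ _ i])
      show "\<rho> \<circ> ?s permutes {..<N}" using \<rho>(1) sp by (simp add: permutes_compose)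
      show "key i \<le> key (Suc i)" if "Suc i < N" for i
        using sorted[OF \<rho>(2) that] by (simp add: key_def)
      show "key ((\<rho> \<circ> ?s) i) \<le> key ((\<rho> \<circ> ?s) (Suc i))" if "Suc i < N" for i
        using sorted[OF \<sigma>(2) that] key[of i] key[of "Suc i"] that by simp
    qed
    then show ?thesis unfolding key[OF i] by (simp add: key_def)
  qed
  moreover have "?s i = ?r i" if "\<not> i < N" for i
    using that sp rp by (simp add: permutes_not_in)
  ultimately have "?s = ?r" by blast
  then have "inv_into UNIV ?s = inv_into UNIV ?r" by simp
  then show ?thesis by (simp add: permutes_inv_inv[OF \<sigma>(1)] permutes_inv_inv[OF \<rho>(1)])
qed

section \<open>Triangularity of the table of marks\<close>

lemma mark_self: "mark N J (block_index J) \<noteq> 0"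
proof -
  have "block_index J \<in> {h \<in> rearrangements N (block_index J). const_on_steps J h}"
    by (simp add: rearrangement_self const_on_steps_def)
  moreover have "finite {h \<in> rearrangements N (block_index J). const_on_steps J h}" by simp
  ultimately show ?thesis unfolding mark_def using card_0_eq by blast
qed

text \<open>
  A rearrangement \<open>f\<close> of \<open>block_index J\<close> that is constant along \<open>M\<close> factors through
  \<open>block_index M\<close>, so there are at least as many blocks of \<open>M\<close> as of \<open>J\<close>. Since the number of
  blocks is \<open>N\<close> minus the number of steps, this gives the inequality of cardinalities. In the
  case of equality the blocks of \<open>M\<close> are the fibres of \<open>f\<close>, and the permutation that sorts \<open>f\<close>
  stably carries the blocks of \<open>J\<close> monotonically onto blocks of \<open>M\<close>, and thus steps to steps.
\<close>

lemma mark_triangular: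
  assumes J: "J \<subseteq> {i. Suc i < N}" and M: "M \<subseteq> {i. Suc i < N}" and N: "N > 0"
    and nz: "mark N M (block_index J) \<noteq> 0"
  shows "card M < card J \<or> step_conj N J M"
proof -
  have "{h \<in> rearrangements N (block_index J). const_on_steps M h} \<noteq> {}"
    using nz by (metis card.empty mark_def)
  then obtain \<pi> where \<pi>: "\<pi> permutes {..<N}" and c: "const_on_steps M (block_index J \<circ> \<pi>)"
    by (auto simp: rearrangements_def)
  let ?I = "{..<N}" and ?f = "block_index J \<circ> \<pi>"
  have ker: "?f x = ?f y" if "x \<in> ?I" "y \<in> ?I" "block_index M x = block_index M y" for x y
    using const_on_block[of M N ?f x y] c that by (auto simp: const_on_steps_def)
  have im: "?f ` ?I = block_index J ` ?I"
    using permutes_image[OF \<pi>] by (metis image_comp)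
  have le: "card M \<le> card J"
    using factor_through(1)[of ?I "block_index M" ?f, OF finite_lessThan ker, unfolded im]
      card_block_index_image[OF J N] card_block_index_image[OF M N] by linarith
  show ?thesis
  proof (cases "card M = card J")
    case False
    then show ?thesis using le by simp
  next
    case True
    then have "card (block_index M ` ?I) = card (?f ` ?I)"
      using im card_block_index_image[OF J N] card_block_index_image[OF M N] by simp
    then have rev: "block_index M x = block_index M y" if "x < N" "y < N" "?f x = ?f y" for x y
      using factor_through(2)[of ?I "block_index M" ?f x y, OF finite_lessThan ker] that by blast
    have "?f \<in> rearrangements N (block_index J)" using \<pi> by (auto simp: rearrangements_def)
    then obtain \<sigma> where \<sigma>: "\<sigma> permutes {..<N}" and f\<sigma>: "?f = block_index J \<circ> \<sigma>"
        and rep: "inv_into UNIV \<sigma> \<in> min_reps N J"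
        and "\<forall>k l. k < l \<longrightarrow> l < N \<longrightarrow> ?f k \<le> ?f l \<longrightarrow> \<sigma> k < \<sigma> l"
      by (rule stable_sort[OF _ J])
    then have mono: "\<sigma> k < \<sigma> l" if "k < l" "l < N" "?f k \<le> ?f l" for k l using that by blast
    define \<tau> where "\<tau> = inv_into UNIV \<sigma>"
    have \<tau>: "\<tau> permutes {..<N}" and \<sigma>\<tau>: "\<sigma> (\<tau> i) = i" for i
      unfolding \<tau>_def using perms_inv[OF \<sigma>] by auto
    have f\<tau>: "?f (\<tau> i) = block_index J i" for i
      unfolding f\<sigma> by (simp add: \<sigma>\<tau>)
    have step: "\<tau> (Suc j) = Suc (\<tau> j) \<and> \<tau> j \<in> M" if j: "j \<in> J" for j
    proof -
      have jN: "\<tau> j < N" "\<tau> (Suc j) < N" using j J by (auto simp: perms_less[OF \<tau>])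
      have lt: "\<tau> j < \<tau> (Suc j)" using rep j by (simp add: min_reps_def \<tau>_def)
      have bM: "block_index M (\<tau> j) = block_index M (\<tau> (Suc j))"
        by (rule rev) (simp_all only: jN f\<tau> block_index_step[OF j])
      have "\<tau> (Suc j) = Suc (\<tau> j)"
      proof (rule ccontr)
        assume "\<tau> (Suc j) \<noteq> Suc (\<tau> j)"
        then obtain k where k: "\<tau> j < k" "k < \<tau> (Suc j)" using lt by (metis Suc_lessI lessI)
        \<comment> \<open>A position strictly between would belong to the same block and be sorted between \<open>j\<close> and \<open>Suc j\<close>.\<close>
        have "block_index M k = block_index M (\<tau> j)"
          using bM k block_index_mono[of "\<tau> j" k M] block_index_mono[of k "\<tau> (Suc j)" M] by simp
        then have "?f k = ?f (\<tau> j)" using k jN by (intro ker) auto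
        then have fk: "?f k = block_index J j" "?f k = block_index J (Suc j)" using f\<tau> j by simp_all
        have "\<sigma> (\<tau> j) < \<sigma> k" "\<sigma> k < \<sigma> (\<tau> (Suc j))"
          using k jN
          using fk f\<tau>[of j] f\<tau>[of "Suc j"] by (auto intro!: mono simp del: comp_apply)
        then show False by (simp add: \<sigma>\<tau>)
      qed
      moreover have "\<tau> j \<in> M" using block_index_eq_imp_step[OF bM] lt by simp
      ultimately show ?thesis by simp
    qed
    have "\<tau> ` J \<subseteq> M" using step by auto
    moreover have "card (\<tau> ` J) = card M"
      using True card_image[of \<tau> J] permutes_inj_on[OF \<tau>] by simp
    moreover have "finite M" using M by (rule finite_subset) (simp add: finite_subset[of _ "{..<N}"] subset_eq)
    ultimately have "\<tau> ` J = M" by (simp add: card_subset_eq)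
    then have "step_conj N J M" using \<tau> step by (auto simp: step_conj_def)
    then show ?thesis ..
  qed
qed

section \<open>Multiplicativity of marks\<close>

text \<open>
  A sorted sequence has the same fibres as the block sequence of the set \<open>E\<close> of steps along which
  it is constant; by \<open>mark_cong\<close> both then have the same marks.
\<close>

lemma sorted_ker_block_index:
  fixes s :: "nat \<Rightarrow> nat"
  assumes s: "\<And>i. Suc i < N \<Longrightarrow> s i \<le> s (Suc i)"
    and E: "\<And>p. Suc p < N \<Longrightarrow> p \<in> E \<longleftrightarrow> s p = s (Suc p)"
    and xy: "x < N" "y < N"
  shows "s x = s y \<longleftrightarrow> block_index E x = block_index E y"
proof
  assume "block_index E x = block_index E y"
  then show "s x = s y" using const_on_block[of E N s x y] E xy by blast
next
  have mono: "s i \<le> s k" if "i \<le> k" "k < N" for i k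
    using that
  proof (induction k rule: dec_induct)
    case (step k)
    then show ?case using s[of k] by simp
  qed simp
  have "block_index E x = block_index E y" if "x \<le> y" "y < N" "s x = s y" for x y
    using that
  proof (induction y rule: dec_induct)
    case (step k)
    have "s x \<le> s k" "s k \<le> s (Suc k)"
      using mono[of x k] s[of k] step.hyps step.prems by auto
    then have "s x = s k" "k \<in> E" using E step by auto
    then show ?case using step by simp
  qed simp
  then show "s x = s y \<Longrightarrow> block_index E x = block_index E y" using xy by (metis nat_le_linear)
qed

text \<open>
  A fixed point of \<open>W\<^sub>M\<close> on \<open>W/W\<^sub>J \<times> W/W\<^sub>K\<close> is a pair \<open>(f, g)\<close> of rearrangements, both constant along
  \<open>M\<close>. Such a pair is regarded as one sequence, with \<open>g\<close> as the leading component. Each orbit of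
  pairs contains exactly one sorted sequence. Its leading component is \<open>block_index K\<close>, and by
  \<open>stable_sort\<close> and \<open>min_rep_unique\<close> its other component is \<open>block_index J \<circ> \<sigma>\<close> for a unique
  \<open>\<sigma> \<in> X\<^sub>J\<^sub>K\<close>. The sequence is constant exactly along the steps in \<open>\<sigma>\<^sup>-\<^sup>1(J) \<inter> K\<close>, so its orbit contributes
  the mark of that step set.
\<close>

theorem mark_mult:
  assumes J: "J \<subseteq> {i. Suc i < N}" and K: "K \<subseteq> {i. Suc i < N}" and M: "M \<subseteq> {i. Suc i < N}"
  shows "mark N M (block_index J) * mark N M (block_index K) =
    (\<Sum>\<sigma>\<in>double_reps N J K. mark N M (block_index (meet_steps J K \<sigma>)))"
proof -
  define pair where "pair f g = (\<lambda>i. N * g i + f i)" for f g :: "nat \<Rightarrow> nat"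
  define s where "s \<sigma> = pair (block_index J \<circ> \<sigma>) (block_index K)" for \<sigma>
  define fixed where "fixed f = {h \<in> rearrangements N f. const_on_steps M h}" for f
  have pair_comp: "pair f g \<circ> \<pi> = pair (f \<circ> \<pi>) (g \<circ> \<pi>)" for f g \<pi>
    by (auto simp: pair_def)
  have dr: "\<sigma> permutes {..<N}" "inv_into UNIV \<sigma> \<in> min_reps N J" "\<sigma> \<in> min_reps N K"
    if "\<sigma> \<in> double_reps N J K" for \<sigma>
    using that by (auto simp: double_reps_def min_reps_def)
  have pair_const: "const_on_steps M (pair f g) \<longleftrightarrow> const_on_steps M f \<and> const_on_steps M g"
    if f: "f \<in> rearrangements N (block_index J)" for f g
  proof -
    have "pair f g i = pair f g (Suc i) \<longleftrightarrow> g i = g (Suc i) \<and> f i = f (Suc i)" if "i \<in> M" for i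
      unfolding pair_def using that M rearrangement_block_index_less[OF f] by (intro digit_eq_iff) auto
    then show ?thesis by (auto simp: const_on_steps_def)
  qed
  have pair_inj: "inj_on (\<lambda>(f, g). pair f g)
      (rearrangements N (block_index J) \<times> rearrangements N (block_index K))"
  proof (rule inj_onI, clarify)
    fix f g f' g'
    assume f: "f \<in> rearrangements N (block_index J)" "f' \<in> rearrangements N (block_index J)"
      and g: "g \<in> rearrangements N (block_index K)" "g' \<in> rearrangements N (block_index K)"
      and eq: "pair f g = pair f' g'"
    have "f i = f' i \<and> g i = g' i" for i
    proof (cases "i < N")
      case True
      then show ?thesis
        using fun_cong[OF eq, of i] f by (auto simp: pair_def digit_eq_iff rearrangement_block_index_less)
    next
      case False
      then show ?thesis using f g by (auto simp: rearrangements_def permutes_not_in)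
    qed
    then show "f = f' \<and> g = g'" by auto
  qed
  have s_sorted: "s \<sigma> i \<le> s \<sigma> (Suc i)" if \<sigma>: "\<sigma> \<in> double_reps N J K" and i: "Suc i < N" for \<sigma> i
  proof -
    have "block_index J (\<sigma> i) \<le> block_index J (\<sigma> (Suc i))" if "i \<in> K"
      using dr(3)[OF \<sigma>] that by (intro block_index_mono) (auto simp: min_reps_def less_imp_le)
    moreover have "block_index J (\<sigma> k) < N" if "k < N" for k
      using block_index_le[of J "\<sigma> k"] that perms_less[OF dr(1)[OF \<sigma>], of k] by simp
    ultimately show ?thesis using i by (auto simp: s_def pair_def digit_le_iff)
  qed
  \<comment> \<open>The fibres of \<open>s \<sigma>\<close> are the blocks of \<open>\<sigma>\<^sup>-\<^sup>1(J) \<inter> K\<close>.\<close>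
  have mark_s: "card (fixed (s \<sigma>)) = mark N M (block_index (meet_steps J K \<sigma>))"
    if \<sigma>: "\<sigma> \<in> double_reps N J K" for \<sigma>
  proof -
    have "mark N M (s \<sigma>) = mark N M (block_index (meet_steps J K \<sigma>))"
    proof (rule mark_cong[OF _ M], rule sorted_ker_block_index)
      fix p assume p: "Suc p < N"
      have less: "block_index J (\<sigma> k) < N" if "k < N" for k
        using block_index_le[of J "\<sigma> k"] that perms_less[OF dr(1)[OF \<sigma>], of k] by simp
      have "s \<sigma> p = s \<sigma> (Suc p) \<longleftrightarrow> p \<in> K \<and> block_index J (\<sigma> p) = block_index J (\<sigma> (Suc p))"
        using p less by (auto simp: s_def pair_def digit_eq_iff)
      also have "\<dots> \<longleftrightarrow> p \<in> meet_steps J K \<sigma>"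
      proof
        assume a: "p \<in> K \<and> block_index J (\<sigma> p) = block_index J (\<sigma> (Suc p))"
        then have lt: "\<sigma> p < \<sigma> (Suc p)" using dr(3)[OF \<sigma>] by (auto simp: min_reps_def)
        have "\<sigma> (Suc p) = Suc (\<sigma> p)"
        proof (rule ccontr)
          assume "\<sigma> (Suc p) \<noteq> Suc (\<sigma> p)"
          then obtain k where k: "\<sigma> p < k" "k < \<sigma> (Suc p)" using lt by (metis Suc_lessI lessI)
          have bk: "block_index J (\<sigma> p) = block_index J k" "block_index J k = block_index J (\<sigma> (Suc p))"
            using a k block_index_mono[of "\<sigma> p" k J] block_index_mono[of k "\<sigma> (Suc p)" J] by auto
          \<comment> \<open>\<open>\<sigma>\<^sup>-\<^sup>1\<close> increases on blocks of \<open>J\<close>, so it would take \<open>k\<close> strictly between \<open>p\<close> and \<open>Suc p\<close>.\<close>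
          have inc: "\<And>j. j \<in> J \<Longrightarrow> inv_into UNIV \<sigma> j < inv_into UNIV \<sigma> (Suc j)"
            using dr(2)[OF \<sigma>] by (auto simp: min_reps_def)
          have "inv_into UNIV \<sigma> (\<sigma> p) < inv_into UNIV \<sigma> k"
            by (rule increasing_on_block[where \<tau>="inv_into UNIV \<sigma>", OF inc bk(1) k(1)])
          moreover have "inv_into UNIV \<sigma> k < inv_into UNIV \<sigma> (\<sigma> (Suc p))"
            by (rule increasing_on_block[where \<tau>="inv_into UNIV \<sigma>", OF inc bk(2) k(2)])
          ultimately show False by (simp add: perms_inv(3)[OF dr(1)[OF \<sigma>]])
        qed
        moreover have "\<sigma> p \<in> J" using block_index_eq_imp_step[of J "\<sigma> p" "\<sigma> (Suc p)" "\<sigma> p"] a lt by simp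
        ultimately show "p \<in> meet_steps J K \<sigma>" using a by (simp add: meet_steps_def)
      qed (simp add: meet_steps_def)
      finally show "p \<in> meet_steps J K \<sigma> \<longleftrightarrow> s \<sigma> p = s \<sigma> (Suc p)" by simp
    qed (use s_sorted[OF \<sigma>] in auto)
    then show ?thesis by (simp add: mark_def fixed_def)
  qed
  \<comment> \<open>Different double coset representatives give different orbits.\<close>
  have s_disjoint: "\<sigma> = \<sigma>'"
    if \<sigma>: "\<sigma> \<in> double_reps N J K" and \<sigma>': "\<sigma>' \<in> double_reps N J K"
      and h: "h \<in> rearrangements N (s \<sigma>)" "h \<in> rearrangements N (s \<sigma>')" for \<sigma> \<sigma>' h
  proof (rule min_rep_unique[OF dr(1,2)[OF \<sigma>] dr(1,2)[OF \<sigma>']])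
    obtain \<pi> \<pi>' where \<pi>: "\<pi> permutes {..<N}" "\<pi>' permutes {..<N}" "s \<sigma> \<circ> \<pi> = s \<sigma>' \<circ> \<pi>'"
      using h by (auto simp: rearrangements_def)
    let ?\<rho> = "\<pi>' \<circ> inv_into UNIV \<pi>"
    have eq: "s \<sigma>' (?\<rho> i) = s \<sigma> i" for i
      using fun_cong[OF \<pi>(3), of "inv_into UNIV \<pi> i"] by (simp add: perms_inv(2)[OF \<pi>(1)])
    fix i assume i: "i < N"
    have "s \<sigma>' (?\<rho> i) = s \<sigma>' i"
    proof (rule rearrangement_sorted_unique[OF _ _ _ i])
      show "?\<rho> permutes {..<N}" using \<pi> perms_inv(1)[OF \<pi>(1)] by (simp add: permutes_compose)
    qed (unfold eq, auto intro: s_sorted \<sigma> \<sigma>')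
    then have "s \<sigma> i = s \<sigma>' i" using eq by simp
    then show "block_index J (\<sigma> i) = block_index J (\<sigma>' i)" by (simp add: s_def pair_def)
  qed
  \<comment> \<open>Sorting puts every pair into one of the orbits.\<close>
  have s_cover: "\<exists>\<sigma>\<in>double_reps N J K. pair f g \<in> rearrangements N (s \<sigma>)"
    if f: "f \<in> rearrangements N (block_index J)" and g: "g \<in> rearrangements N (block_index K)" for f g
  proof -
    obtain \<alpha> where \<alpha>: "\<alpha> permutes {..<N}" "f = block_index J \<circ> \<alpha>" using f by (auto simp: rearrangements_def)
    obtain \<beta> where \<beta>: "\<beta> permutes {..<N}" "g = block_index K \<circ> \<beta>" using g by (auto simp: rearrangements_def)
    have "inj_on (\<lambda>i. N * pair f g i + i) {..<N}" by (auto simp: inj_on_def digit_eq_iff)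
    then obtain \<pi> where \<pi>: "\<pi> permutes {..<N}" and srt: "\<And>i. Suc i < N \<Longrightarrow>
        N * pair f g (\<pi> i) + \<pi> i < N * pair f g (\<pi> (Suc i)) + \<pi> (Suc i)"
      by (rule sorting_permutation_exists) blast
    have "pair f g (\<pi> i) \<le> pair f g (\<pi> (Suc i))" if "Suc i < N" for i
      using srt[OF that] that by (auto simp: digit_less_iff perms_less[OF \<pi>])
    then have lex: "g (\<pi> i) < g (\<pi> (Suc i)) \<or> g (\<pi> i) = g (\<pi> (Suc i)) \<and> f (\<pi> i) \<le> f (\<pi> (Suc i))"
      if "Suc i < N" for i
      using that rearrangement_block_index_less[OF f] by (simp add: pair_def digit_le_iff perms_less[OF \<pi>])
    have g\<pi>: "g (\<pi> i) = block_index K i" for i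
    proof (cases "i < N")
      case True
      have "block_index K ((\<beta> \<circ> \<pi>) i) = block_index K i"
      proof (rule rearrangement_sorted_unique[OF _ _ _ True])
        show "\<beta> \<circ> \<pi> permutes {..<N}" using \<beta>(1) \<pi> by (simp add: permutes_compose)
        show "block_index K ((\<beta> \<circ> \<pi>) i) \<le> block_index K ((\<beta> \<circ> \<pi>) (Suc i))" if "Suc i < N" for i
          using lex[OF that] by (auto simp: \<beta>(2))
      qed auto
      then show ?thesis by (simp add: \<beta>(2))
    next
      case False
      then show ?thesis using \<pi> \<beta> by (simp add: permutes_not_in)
    qed
    have "f \<circ> \<pi> \<in> rearrangements N (block_index J)"
      using \<alpha> \<pi> by (auto simp: rearrangements_def comp_assoc permutes_compose)
    then obtain \<sigma> where \<sigma>: "\<sigma> permutes {..<N}" "f \<circ> \<pi> = block_index J \<circ> \<sigma>" "inv_into UNIV \<sigma> \<in> min_reps N J"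
      and "\<forall>k l. k < l \<longrightarrow> l < N \<longrightarrow> (f \<circ> \<pi>) k \<le> (f \<circ> \<pi>) l \<longrightarrow> \<sigma> k < \<sigma> l"
      by (rule stable_sort[OF _ J])
    then have mono: "\<sigma> k < \<sigma> l" if "k < l" "l < N" "(f \<circ> \<pi>) k \<le> (f \<circ> \<pi>) l" for k l
      using that by blast
    have "\<sigma> p < \<sigma> (Suc p)" if "p \<in> K" for p
    proof -
      have p: "Suc p < N" using that K by auto
      then show ?thesis using lex[OF p] that by (intro mono) (auto simp: g\<pi>)
    qed
    then have DR: "\<sigma> \<in> double_reps N J K" using \<sigma> by (simp add: double_reps_def min_reps_def)
    have "pair f g \<circ> \<pi> = s \<sigma>"
      unfolding s_def \<sigma>(2)[symmetric] pair_comp using g\<pi> by (simp add: comp_def)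
    then have "pair f g \<in> rearrangements N (s \<sigma>)" using rearrangement_comp[OF \<pi>] rearrangement_self by metis
    then show ?thesis using DR by blast
  qed
  have s_sub: "rearrangements N (s \<sigma>) \<subseteq>
      (\<lambda>(f, g). pair f g) ` (rearrangements N (block_index J) \<times> rearrangements N (block_index K))"
    if \<sigma>: "\<sigma> \<in> double_reps N J K" for \<sigma>
  proof
    fix h assume "h \<in> rearrangements N (s \<sigma>)"
    then obtain \<pi> where \<pi>: "\<pi> permutes {..<N}" "h = s \<sigma> \<circ> \<pi>" by (auto simp: rearrangements_def)
    have "h = pair (block_index J \<circ> (\<sigma> \<circ> \<pi>)) (block_index K \<circ> \<pi>)" by (simp add: \<pi>(2) s_def pair_comp comp_assoc)
    moreover have "block_index J \<circ> (\<sigma> \<circ> \<pi>) \<in> rearrangements N (block_index J)"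
        "block_index K \<circ> \<pi> \<in> rearrangements N (block_index K)"
      using \<pi>(1) dr(1)[OF \<sigma>] by (auto simp: rearrangements_def permutes_compose)
    ultimately show "h \<in> (\<lambda>(f, g). pair f g) `
        (rearrangements N (block_index J) \<times> rearrangements N (block_index K))" by auto
  qed
  have image: "(\<lambda>(f, g). pair f g) ` (fixed (block_index J) \<times> fixed (block_index K)) =
      (\<Union>\<sigma>\<in>double_reps N J K. fixed (s \<sigma>))" (is "?L = ?R")
  proof
    show "?L \<subseteq> ?R" using s_cover pair_const unfolding fixed_def by fastforce
    show "?R \<subseteq> ?L"
    proof
      fix h assume "h \<in> ?R"
      then obtain \<sigma> where \<sigma>: "\<sigma> \<in> double_reps N J K" and h: "h \<in> rearrangements N (s \<sigma>)" "const_on_steps M h"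
        by (auto simp: fixed_def)
      then obtain f g where fg: "f \<in> rearrangements N (block_index J)"
          "g \<in> rearrangements N (block_index K)" "h = pair f g"
        using s_sub[OF \<sigma>] by auto
      then show "h \<in> ?L" using pair_const[OF fg(1), of g] h by (force simp: fixed_def)
    qed
  qed
  have "mark N M (block_index J) * mark N M (block_index K) = card (fixed (block_index J) \<times> fixed (block_index K))"
    by (simp add: mark_def fixed_def card_cartesian_product)
  also have "\<dots> = card ((\<lambda>(f, g). pair f g) ` (fixed (block_index J) \<times> fixed (block_index K)))"
    by (rule card_image[symmetric], rule inj_on_subset[OF pair_inj]) (auto simp: fixed_def)
  also have "\<dots> = card (\<Union>\<sigma>\<in>double_reps N J K. fixed (s \<sigma>))" by (simp only: image)
  also have "\<dots> = (\<Sum>\<sigma>\<in>double_reps N J K. card (fixed (s \<sigma>)))"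
  proof (rule card_UN_disjoint)
    show "finite (double_reps N J K)"
      by (rule finite_subset[OF _ finite_perms[of N]]) (auto simp: double_reps_def min_reps_def)
    show "\<forall>\<sigma>\<in>double_reps N J K. \<forall>\<sigma>'\<in>double_reps N J K. \<sigma> \<noteq> \<sigma>' \<longrightarrow> fixed (s \<sigma>) \<inter> fixed (s \<sigma>') = {}"
      using s_disjoint by (auto simp: fixed_def)
  qed (simp add: fixed_def)
  also have "\<dots> = (\<Sum>\<sigma>\<in>double_reps N J K. mark N M (block_index (meet_steps J K \<sigma>)))"
    by (rule sum.cong) (simp_all add: mark_s)
  finally show ?thesis .
qed

section \<open>Semi-simplicity from separating characters\<close>

text \<open>
  Back substitution: an index \<open>Y\<close> of least rank does not occur in the equations of the other
  indices, so these can be solved first, and the equation of \<open>Y\<close> then determines the value at \<open>Y\<close>.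
\<close>

lemma triangular_system_solvable:
  fixes c :: "'b \<Rightarrow> 'b \<Rightarrow> 'k::field" and rk :: "'b \<Rightarrow> nat"
  assumes "finite B"
    and "\<And>C. C \<in> B \<Longrightarrow> c C C \<noteq> 0"
    and "\<And>C D. \<lbrakk>C \<in> B; D \<in> B; C \<noteq> D; c C D \<noteq> 0\<rbrakk> \<Longrightarrow> rk C < rk D"
  shows "\<exists>f. \<forall>C\<in>B. (\<Sum>D\<in>B. c C D * f D) = t C"
  using assms
proof (induction B rule: finite_ranking_induct[where f="\<lambda>C. - int (rk C)"])
  case empty
  then show ?case by simp
next
  case (insert Y S)
  show ?case
  proof (cases "Y \<in> S")
    case True
    then show ?thesis using insert by (simp add: insert_absorb)
  next
    case False
    have low: "rk Y \<le> rk C" if "C \<in> S" for C using insert.hyps(2)[OF that] by simp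
    obtain f where f: "\<And>C. C \<in> S \<Longrightarrow> (\<Sum>D\<in>S. c C D * f D) = t C"
      using insert.IH insert.prems by (metis insertCI)
    define g where "g = f(Y := (t Y - (\<Sum>D\<in>S. c Y D * f D)) / c Y Y)"
    have same: "(\<Sum>D\<in>S. c C D * g D) = (\<Sum>D\<in>S. c C D * f D)" for C
      using False by (intro sum.cong) (auto simp: g_def)
    have "(\<Sum>D\<in>insert Y S. c C D * g D) = t C" if "C \<in> insert Y S" for C
    proof (cases "C = Y")
      case True
      then show ?thesis using insert.hyps(1) False insert.prems(1)[of Y] same
        by (simp add: g_def)
    next
      case C: False
      then have "c C Y = 0" using insert.prems(2)[of C Y] low[of C] that by force
      then show ?thesis using insert.hyps(1) False C that same f by simp
    qed
    then show ?thesis by blast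
  qed
qed

text \<open>
  At an index of greatest rank in the support of \<open>f\<close>, only the diagonal term of the equation
  survives.
\<close>

lemma triangular_system_injective:
  fixes c :: "'b \<Rightarrow> 'b \<Rightarrow> 'k::field" and rk :: "'b \<Rightarrow> nat"
  assumes fin: "finite B"
    and diag: "\<And>C. C \<in> B \<Longrightarrow> c C C \<noteq> 0"
    and tri: "\<And>C D. \<lbrakk>C \<in> B; D \<in> B; C \<noteq> D; c C D \<noteq> 0\<rbrakk> \<Longrightarrow> rk C < rk D"
    and zero: "\<And>C. C \<in> B \<Longrightarrow> (\<Sum>D\<in>B. c C D * f D) = 0"
    and D: "D \<in> B"
  shows "f D = 0"
proof (rule ccontr)
  assume "f D \<noteq> 0"
  define S where "S = {C \<in> B. f C \<noteq> 0}"
  have "finite S" "S \<noteq> {}" using fin D \<open>f D \<noteq> 0\<close> by (auto simp: S_def)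
  then obtain C where C: "C \<in> S" "\<And>Y. Y \<in> S \<Longrightarrow> rk Y \<le> rk C"
    using obtains_MAX[of S rk] by (metis Max_ge finite_imageI imageI)
  have "(\<Sum>Y\<in>B. c C Y * f Y) = (\<Sum>Y\<in>{C}. c C Y * f Y)"
  proof (rule sum.mono_neutral_right)
    show "\<forall>Y\<in>B - {C}. c C Y * f Y = 0"
    proof
      fix Y assume "Y \<in> B - {C}"
      then show "c C Y * f Y = 0"
        using tri[of C Y] C(2)[of Y] C(1) by (force simp: S_def)
    qed
  qed (use fin C in \<open>auto simp: S_def\<close>)
  also have "\<dots> \<noteq> 0" using diag C(1) by (simp add: S_def)
  finally show False using zero C(1) by (simp add: S_def)
qed

text \<open>
  The characters \<open>ch i\<close> embed \<open>A\<close> into a product of copies of the ground field, so every identity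
  that \<open>A\<close> has to satisfy can be checked after applying them. The elements \<open>\<epsilon> i\<close> are then
  orthogonal idempotents with sum one, and \<open>a \<epsilon> i = ch i a \<cdot> \<epsilon> i\<close> for all \<open>a\<close>. Hence the lines
  \<open>I i\<close> spanned by them are left ideals; being lines, they are simple, and the component of \<open>x\<close>
  in \<open>I i\<close> has to be \<open>ch i x \<cdot> \<epsilon> i\<close>.
\<close>

lemma semisimple_of_dual_characters:
  fixes A :: "('k::field, 'v::ab_group_add) module" and ch :: "'i \<Rightarrow> 'v \<Rightarrow> 'k"
  assumes add: "\<And>x y. x \<oplus>\<^bsub>A\<^esub> y = x + y" and zero: "\<zero>\<^bsub>A\<^esub> = 0"
    and closed: "0 \<in> carrier A" "\<one>\<^bsub>A\<^esub> \<in> carrier A"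
      "\<And>x y. \<lbrakk>x \<in> carrier A; y \<in> carrier A\<rbrakk> \<Longrightarrow> x + y \<in> carrier A"
      "\<And>x. x \<in> carrier A \<Longrightarrow> - x \<in> carrier A"
      "\<And>q x. x \<in> carrier A \<Longrightarrow> q \<odot>\<^bsub>A\<^esub> x \<in> carrier A"
      "\<And>x y. \<lbrakk>x \<in> carrier A; y \<in> carrier A\<rbrakk> \<Longrightarrow> x \<otimes>\<^bsub>A\<^esub> y \<in> carrier A"
    and char: "\<And>i x y. \<lbrakk>i \<in> S; x \<in> carrier A; y \<in> carrier A\<rbrakk> \<Longrightarrow> ch i (x + y) = ch i x + ch i y"
      "\<And>i q x. \<lbrakk>i \<in> S; x \<in> carrier A\<rbrakk> \<Longrightarrow> ch i (q \<odot>\<^bsub>A\<^esub> x) = q * ch i x"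
      "\<And>i x y. \<lbrakk>i \<in> S; x \<in> carrier A; y \<in> carrier A\<rbrakk> \<Longrightarrow> ch i (x \<otimes>\<^bsub>A\<^esub> y) = ch i x * ch i y"
      "\<And>i. i \<in> S \<Longrightarrow> ch i \<one>\<^bsub>A\<^esub> = 1"
    and separating: "\<And>x. \<lbrakk>x \<in> carrier A; \<And>i. i \<in> S \<Longrightarrow> ch i x = 0\<rbrakk> \<Longrightarrow> x = 0"
    and S: "finite S"
    and dual: "\<And>i. i \<in> S \<Longrightarrow> \<epsilon> i \<in> carrier A"
      "\<And>i j. \<lbrakk>i \<in> S; j \<in> S\<rbrakk> \<Longrightarrow> ch j (\<epsilon> i) = (if i = j then 1 else 0)"
  shows "semisimple_algebra (ring_of_type_algebra :: 'k ring) A"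
proof -
  let ?K = "ring_of_type_algebra :: 'k ring"
  have ch0: "ch i 0 = 0" if "i \<in> S" for i
    using char(1)[OF that closed(1) closed(1)] by (metis add_0 add_cancel_left_right)
  have ch_neg: "ch i (- x) = - ch i x" if "i \<in> S" "x \<in> carrier A" for i x
    using char(1)[OF that closed(4)[OF that(2)]] ch0[OF that(1)] by (simp add: eq_neg_iff_add_eq_0 add.commute)
  have eqI: "x = y" if x: "x \<in> carrier A" and y: "y \<in> carrier A" and eq: "\<And>i. i \<in> S \<Longrightarrow> ch i x = ch i y" for x y
  proof -
    have "ch i (x + - y) = 0" if i: "i \<in> S" for i
      using char(1)[OF i x closed(4)[OF y]] ch_neg[OF i y] eq[OF i] by simp
    then have "x + - y = 0" by (intro separating closed(3) closed(4) x y)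
    then show ?thesis by simp
  qed
  have [simp]: "carrier ?K = UNIV" "\<one>\<^bsub>?K\<^esub> = 1" "x \<oplus>\<^bsub>?K\<^esub> y = x + y" "x \<otimes>\<^bsub>?K\<^esub> y = x * y" for x y
    by (simp_all add: ring_of_type_algebra_def)
  have group: "abelian_group A"
    by (rule abelian_groupI) (auto simp: add zero closed add.assoc add.commute intro!: bexI[of _ "- x" for x])
  have ring: "Ring.ring A"
  proof (rule ringI[OF group])
    show "monoid A"
      by (rule monoidI) (auto intro!: eqI simp: closed char)
  qed (auto intro!: eqI simp: add closed char algebra_simps)
  have module: "Module.module ?K A"
    by (rule moduleI[OF cring_from_type_algebra group])
      (auto intro!: eqI simp: add closed char algebra_simps)
  have assoc: "assoc_algebra ?K A"
    unfolding assoc_algebra_def using ring module by (auto intro!: eqI simp: closed char)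
  interpret A: abelian_group A by (rule group)
  have neg: "\<ominus>\<^bsub>A\<^esub> x = - x" if "x \<in> carrier A" for x
    by (rule A.minus_equality) (use that in \<open>simp_all add: add zero closed\<close>)
  define I where "I i = range (\<lambda>q. q \<odot>\<^bsub>A\<^esub> \<epsilon> i)" for i
  have I_carrier: "x \<in> carrier A" if "x \<in> I i" "i \<in> S" for x i
    using that closed(5) dual(1) by (auto simp: I_def)
  have I_char: "ch j x = 0" if "x \<in> I i" "i \<in> S" "j \<in> S" "i \<noteq> j" for x i j
    using that char(2) dual by (auto simp: I_def)
  have I_eq: "x = ch i x \<odot>\<^bsub>A\<^esub> \<epsilon> i" if "x \<in> I i" "i \<in> S" for x i
    using that char(2) dual by (auto simp: I_def)
  have I_mem: "x \<in> I i" if "x \<in> carrier A" "i \<in> S" "\<And>j. \<lbrakk>j \<in> S; j \<noteq> i\<rbrakk> \<Longrightarrow> ch j x = 0" for x i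
  proof -
    have "x = ch i x \<odot>\<^bsub>A\<^esub> \<epsilon> i"
      using that by (intro eqI) (auto simp: closed char dual)
    then show ?thesis by (auto simp: I_def)
  qed
  have left: "left_ideal ?K A (I i)" if i: "i \<in> S" for i
    unfolding left_ideal_def
  proof (intro conjI ballI)
    note IC = I_carrier[OF _ i] and IZ = I_char[OF _ i]
    show "submodule (I i) ?K A"
    proof (rule module.submoduleI[OF module])
      show "I i \<subseteq> carrier A" using IC by blast
      show "\<zero>\<^bsub>A\<^esub> \<in> I i" unfolding zero by (rule I_mem[OF closed(1) i ch0])
      fix a b assume a: "a \<in> I i"
      have "ch j (- a) = 0" if "j \<in> S" "j \<noteq> i" for j
        using ch_neg[OF that(1) IC[OF a]] IZ[OF a that(1)] that(2) by simp
      then show "\<ominus>\<^bsub>A\<^esub> a \<in> I i"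
        unfolding neg[OF IC[OF a]] using closed(4)[OF IC[OF a]] i by (intro I_mem)
      assume b: "b \<in> I i"
      have "ch j (a + b) = 0" if "j \<in> S" "j \<noteq> i" for j
        using char(1)[OF that(1) IC[OF a] IC[OF b]] IZ[OF a that(1)] IZ[OF b that(1)] that(2) by simp
      then show "a \<oplus>\<^bsub>A\<^esub> b \<in> I i"
        unfolding add using closed(3)[OF IC[OF a] IC[OF b]] i by (intro I_mem)
    next
      fix q x assume x: "x \<in> I i"
      have "ch j (q \<odot>\<^bsub>A\<^esub> x) = 0" if "j \<in> S" "j \<noteq> i" for j
        using char(2)[OF that(1) IC[OF x]] IZ[OF x that(1)] that(2) by simp
      then show "q \<odot>\<^bsub>A\<^esub> x \<in> I i"
        using closed(5)[OF IC[OF x]] i by (intro I_mem)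
    qed
    fix a x assume a: "a \<in> carrier A" and x: "x \<in> I i"
    have "ch j (a \<otimes>\<^bsub>A\<^esub> x) = 0" if "j \<in> S" "j \<noteq> i" for j
      using char(3)[OF that(1) a IC[OF x]] IZ[OF x that(1)] that(2) by simp
    then show "a \<otimes>\<^bsub>A\<^esub> x \<in> I i"
      using closed(6)[OF a IC[OF x]] i by (intro I_mem)
  qed
  have simple: "simple_left_ideal ?K A (I i)" if i: "i \<in> S" for i
    unfolding simple_left_ideal_def
  proof (intro conjI allI impI left[OF i])
    have \<epsilon>I: "\<epsilon> i \<in> I i" using i by (intro I_mem) (auto simp: dual)
    have "ch i (\<epsilon> i) \<noteq> ch i 0" using i by (simp add: dual ch0)
    then show "I i \<noteq> {\<zero>\<^bsub>A\<^esub>}" using \<epsilon>I zero by (metis singletonD)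
    fix I' assume I': "left_ideal ?K A I' \<and> I' \<subseteq> I i"
    then have sub: "submodule I' ?K A" by (simp add: left_ideal_def)
    then have "0 \<in> I'"
      using subgroup.one_closed[OF submodule.axioms(1)[OF sub]] by (simp add: zero)
    show "I' = {\<zero>\<^bsub>A\<^esub>} \<or> I' = I i"
    proof (cases "I' \<subseteq> {0}")
      case True
      then show ?thesis using \<open>0 \<in> I'\<close> by (auto simp: zero)
    next
      case False
      then obtain x where x: "x \<in> I'" "x \<noteq> 0" by auto
      have xI: "x \<in> I i" using x I' by auto
      have q: "ch i x \<noteq> 0"
      proof
        assume "ch i x = 0"
        then have "ch j x = 0" if "j \<in> S" for j
          using I_char[OF xI i that] by (cases "i = j") auto
        then have "x = 0" by (rule separating[OF I_carrier[OF xI i]])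
        then show False using x by simp
      qed
      have "y \<in> I'" if y: "y \<in> I i" for y
      proof -
        have "y = (ch i y / ch i x) \<odot>\<^bsub>A\<^esub> x"
        proof (rule eqI)
          fix j assume j: "j \<in> S"
          show "ch j y = ch j ((ch i y / ch i x) \<odot>\<^bsub>A\<^esub> x)"
            using q char(2)[OF j I_carrier[OF xI i]] I_char[OF y i j] I_char[OF xI i j]
            by (cases "i = j") auto
        qed (use I_carrier[OF _ i] y xI closed(5) in auto)
        also have "\<dots> \<in> I'" using submodule.smult_closed[OF sub _ x(1)] by simp
        finally show ?thesis .
      qed
      then show ?thesis using I' by blast
    qed
  qed
  have I_inj: "inj_on I S"
  proof (rule inj_onI, rule ccontr)
    fix i j assume ij: "i \<in> S" "j \<in> S" "I i = I j" "i \<noteq> j"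
    have "\<epsilon> i \<in> I i" using ij(1) by (intro I_mem) (auto simp: dual)
    then have "ch i (\<epsilon> i) = 0" using ij I_char[of "\<epsilon> i" j i] by simp
    then show False using dual(2)[of i i] ij by simp
  qed
  have fsum: "finsum A f \<J> \<in> carrier A \<and> (\<forall>j\<in>S. ch j (finsum A f \<J>) = (\<Sum>L\<in>\<J>. ch j (f L)))"
    if "finite \<J>" "\<And>L. L \<in> \<J> \<Longrightarrow> f L \<in> carrier A" for f :: "'v set \<Rightarrow> 'v" and \<J>
    using that
  proof (induction \<J> rule: finite_induct)
    case empty
    then show ?case by (simp add: zero closed ch0)
  next
    case (insert L \<J>)
    then show ?case by (simp add: A.finsum_insert Pi_def add char(1) closed(3))
  qed
  have fsum_char: "finsum A f (I ` S) \<in> carrier A" "\<And>j. j \<in> S \<Longrightarrow> ch j (finsum A f (I ` S)) = ch j (f (I j))"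
    if f: "f \<in> (\<Pi>\<^sub>E L\<in>I ` S. L)" for f
  proof -
    have fI: "f (I i) \<in> I i" if "i \<in> S" for i using f that by auto
    have *: "finite (I ` S)" "\<And>L. L \<in> I ` S \<Longrightarrow> f L \<in> carrier A"
      using S I_carrier[OF fI] by auto
    show "finsum A f (I ` S) \<in> carrier A" using fsum[OF *] by simp
    fix j assume j: "j \<in> S"
    have "ch j (finsum A f (I ` S)) = (\<Sum>i\<in>S. ch j (f (I i)))"
      using fsum[OF *] j by (simp add: sum.reindex[OF I_inj])
    also have "\<dots> = (\<Sum>i\<in>{j}. ch j (f (I i)))"
      using S j I_char[OF fI] by (intro sum.mono_neutral_right) auto
    finally show "ch j (finsum A f (I ` S)) = ch j (f (I j))" by simp
  qed
  have "\<exists>!f. f \<in> (\<Pi>\<^sub>E L\<in>I ` S. L) \<and> x = finsum A f (I ` S)" if x: "x \<in> carrier A" for x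
  proof (rule ex1I)
    define f where "f = (\<lambda>L\<in>I ` S. ch (inv_into S I L) x \<odot>\<^bsub>A\<^esub> \<epsilon> (inv_into S I L))"
    have fI: "f (I i) = ch i x \<odot>\<^bsub>A\<^esub> \<epsilon> i" if "i \<in> S" for i
      using that I_inj by (simp add: f_def)
    have f: "f \<in> (\<Pi>\<^sub>E L\<in>I ` S. L)"
    proof (rule PiE_I)
      fix L assume "L \<in> I ` S"
      then show "f L \<in> L" using fI by (auto simp: I_def)
    qed (simp add: f_def)
    moreover have "x = finsum A f (I ` S)"
      by (rule eqI[OF x]) (use fsum_char[OF f] fI dual char(2) in auto)
    ultimately show "f \<in> (\<Pi>\<^sub>E L\<in>I ` S. L) \<and> x = finsum A f (I ` S)" ..
    fix g assume g: "g \<in> (\<Pi>\<^sub>E L\<in>I ` S. L) \<and> x = finsum A g (I ` S)"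
    show "g = f"
    proof (rule PiE_ext)
      fix L assume "L \<in> I ` S"
      then obtain i where i: "i \<in> S" "L = I i" by blast
      have "g (I i) \<in> I i" using g i by auto
      then have "g (I i) = ch i (g (I i)) \<odot>\<^bsub>A\<^esub> \<epsilon> i" using i I_eq by blast
      also have "ch i (g (I i)) = ch i x" using fsum_char(2)[of g i] g i by simp
      finally show "g L = f L" using fI i by simp
    qed (use f g in blast)+
  qed
  moreover have "Ring.field ?K" by (rule field_from_type_algebra)
  ultimately show ?thesis
    unfolding semisimple_algebra_def using assoc simple S
    by (intro conjI exI[of _ "I ` S"]) auto
qed

section \<open>The reflection group of type A as a permutation group\<close>

text \<open>
  The frame is indexed from zero, so that \<open>\<pi> permutes {..<Suc n}\<close> describes the action of \<open>W\<close> on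
  it and the simple roots are indexed by \<open>{..<n}\<close>.
\<close>

locale orthonormal_frame =
  fixes n :: nat and u :: "nat \<Rightarrow> 'a::euclidean_space"
  assumes dim: "DIM('a) = Suc n"
    and orthonormal: "\<lbrakk>i < Suc n; j < Suc n\<rbrakk> \<Longrightarrow> u i \<bullet> u j = (if i = j then 1 else 0)"
begin

definition roots :: "'a set" where
  "roots = {u i - u j | i j. i < Suc n \<and> j < Suc n \<and> i \<noteq> j}"

definition simple_root :: "nat \<Rightarrow> 'a" where
  "simple_root i = u i - u (Suc i)"

definition simples :: "'a set" where
  "simples = simple_root ` {..<n}"

definition act :: "(nat \<Rightarrow> nat) \<Rightarrow> 'a \<Rightarrow> 'a" where
  "act \<pi> v = (\<Sum>i<Suc n. (v \<bullet> u i) *\<^sub>R u (\<pi> i))"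

lemma frame_inj: "inj_on u {..<Suc n}"
  by (rule inj_onI) (metis orthonormal lessThan_iff zero_neq_one)

lemma frame_expand: "(\<Sum>i<Suc n. (v \<bullet> u i) *\<^sub>R u i) = v"
proof -
  have orth: "pairwise orthogonal (u ` {..<Suc n})"
    by (auto simp: pairwise_def orthogonal_def orthonormal)
  have "0 \<notin> u ` {..<Suc n}"
    using orthonormal by (metis imageE inner_zero_left lessThan_iff zero_neq_one)
  with orth have ind: "independent (u ` {..<Suc n})"
    by (rule pairwise_orthogonal_independent)
  have "card (u ` {..<Suc n}) = DIM('a)"
    by (simp only: card_image[OF frame_inj] dim card_lessThan)
  then have "UNIV \<subseteq> span (u ` {..<Suc n})"
    using ind by (intro card_ge_dim_independent) auto
  then have "(\<Sum>x\<in>u ` {..<Suc n}. (v \<bullet> x) *\<^sub>R x) = v"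
    using orth by (intro orthonormal_basis_expand) (auto simp: norm_eq_1 orthonormal)
  then show ?thesis by (simp only: sum.reindex[OF frame_inj] comp_def)
qed

lemma frame_eqI:
  assumes "linear f" "linear g" "\<And>i. i < Suc n \<Longrightarrow> f (u i) = g (u i)"
  shows "f = g"
proof
  fix v
  have "f (\<Sum>i<Suc n. (v \<bullet> u i) *\<^sub>R u i) = g (\<Sum>i<Suc n. (v \<bullet> u i) *\<^sub>R u i)"
    using assms(3) by (simp add: linear_sum[OF assms(1)] linear_sum[OF assms(2)] linear_scale[OF assms(1)]
        linear_scale[OF assms(2)] del: sum.lessThan_Suc)
  then show "f v = g v" by (simp only: frame_expand)
qed

lemma linear_act: "linear (act \<pi>)"
  by (rule linearI) (simp_all add: act_def inner_add_left scaleR_add_left sum.distrib scaleR_sum_right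
      del: sum.lessThan_Suc)

lemma act_frame:
  assumes "i < Suc n"
  shows "act \<pi> (u i) = u (\<pi> i)"
proof -
  have "act \<pi> (u i) = (\<Sum>k<Suc n. if k = i then u (\<pi> k) else 0)"
    unfolding act_def using assms by (intro sum.cong) (auto simp: orthonormal)
  then show ?thesis using assms by (simp del: sum.lessThan_Suc)
qed

lemma act_comp: "\<sigma> permutes {..<Suc n} \<Longrightarrow> act (\<pi> \<circ> \<sigma>) = act \<pi> \<circ> act \<sigma>"
  by (rule frame_eqI) (auto intro: linear_compose linear_act simp: act_frame perms_less)

lemma act_id: "act id = id"
  by (rule frame_eqI) (auto intro: linear_act linear_id simp: act_frame)

lemma act_inj:
  assumes "\<pi> permutes {..<Suc n}" "\<sigma> permutes {..<Suc n}" "act \<pi> = act \<sigma>"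
  shows "\<pi> = \<sigma>"
proof
  fix i
  show "\<pi> i = \<sigma> i"
  proof (cases "i < Suc n")
    case True
    then have "u (\<pi> i) = u (\<sigma> i)" using assms(3) by (metis act_frame)
    then show ?thesis using True assms by (auto dest: inj_onD[OF frame_inj] simp: perms_less)
  next
    case False
    then show ?thesis using assms by (simp add: permutes_not_in)
  qed
qed

lemma act_inv:
  assumes "\<pi> permutes {..<Suc n}"
  shows "bij (act \<pi>)" "inv_into UNIV (act \<pi>) = act (inv_into UNIV \<pi>)"
proof -
  have 1: "act (inv_into UNIV \<pi>) \<circ> act \<pi> = id" "act \<pi> \<circ> act (inv_into UNIV \<pi>) = id"
    using perms_inv[OF assms] assms by (simp_all add: act_comp[symmetric] act_id)
  then show "bij (act \<pi>)" by (rule o_bij)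
  show "inv_into UNIV (act \<pi>) = act (inv_into UNIV \<pi>)"
    using 1 by (rule inv_unique_comp[rotated])
qed

lemma reflection_eq_act:
  assumes "i < Suc n" "j < Suc n" "i \<noteq> j"
  shows "root_reflection (u i - u j) = act (Transposition.transpose i j)"
proof (rule frame_eqI)
  have "(u i - u j) \<bullet> (u i - u j) = 2"
    using assms by (simp add: inner_diff_left inner_diff_right orthonormal)
  then have r: "root_reflection (u i - u j) v = v - (v \<bullet> (u i - u j)) *\<^sub>R (u i - u j)" for v
    by (simp add: root_reflection_def)
  show "linear (root_reflection (u i - u j))"
    by (rule linearI) (simp_all add: r inner_add_left scaleR_add_left scaleR_diff_right)
  fix k assume k: "k < Suc n"
  then show "root_reflection (u i - u j) (u k) = act (Transposition.transpose i j) (u k)"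
    using assms by (auto simp: r act_frame inner_diff_right orthonormal Transposition.transpose_def)
qed (rule linear_act)

text \<open>
  The reflections in the roots act on the frame as the transpositions, and these generate the
  symmetric group.
\<close>

lemma refl_group_eq: "refl_group roots = act ` perms (Suc n)"
proof -
  let ?G = "BijGroup (UNIV :: 'a set)"
  have G: "group ?G" by (rule group_BijGroup)
  have mult: "f \<otimes>\<^bsub>?G\<^esub> g = f \<circ> g" if "bij f" "bij g" for f g
    using that by (simp add: BijGroup_def Bij_def compose_def fun_eq_iff)
  have one: "\<one>\<^bsub>?G\<^esub> = id" by (auto simp: BijGroup_def)
  have carrier: "f \<in> carrier ?G \<longleftrightarrow> bij f" for f by (simp add: BijGroup_def Bij_def)
  have tr: "Transposition.transpose i j permutes {..<Suc n}" if "i < Suc n" "j < Suc n" for i j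
    using that by (simp add: permutes_swap_id)
  have refl: "\<exists>i j. i < Suc n \<and> j < Suc n \<and> i \<noteq> j \<and> h = act (Transposition.transpose i j)"
    if h: "h \<in> root_reflection ` roots" for h
  proof -
    obtain r where "r \<in> roots" and hr: "h = root_reflection r" using h by blast
    then obtain i j where "i < Suc n" "j < Suc n" "i \<noteq> j" "r = u i - u j" by (auto simp: roots_def)
    then show ?thesis using reflection_eq_act hr by blast
  qed
  have mem: "act \<pi> \<in> act ` perms (Suc n)" if "\<pi> permutes {..<Suc n}" for \<pi> using that by simp
  show ?thesis unfolding refl_group_def
  proof (intro equalityI subsetI)
    fix w assume "w \<in> generate ?G (root_reflection ` roots)"
    then show "w \<in> act ` perms (Suc n)"
    proof (induction rule: generate.induct)
      case one
      then show ?case using mem[OF permutes_id] by (simp add: BijGroup_def id_def act_id[unfolded id_def])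
    next
      case (incl h)
      then show ?case using refl[OF incl] tr by blast
    next
      case (inv h)
      obtain i j where h: "i < Suc n" "j < Suc n" "h = act (Transposition.transpose i j)" using refl[OF inv] by blast
      have b: "bij h" using act_inv(1)[OF tr] h by blast
      have "h \<circ> h = id"
        using act_comp[OF tr[OF h(1,2)], of "Transposition.transpose i j"] h(3) by (simp add: act_id)
      then have "inv\<^bsub>?G\<^esub> h = h"
        using b by (intro group.inv_equality[OF G]) (simp_all add: mult one carrier)
      then show ?case using h tr by simp
    next
      case (eng f g)
      then obtain \<pi> \<sigma> where "\<pi> permutes {..<Suc n}" "f = act \<pi>" "\<sigma> permutes {..<Suc n}" "g = act \<sigma>"
        by blast
      then show ?case using act_inv(1) mult mem[OF permutes_compose] by (simp add: act_comp[symmetric])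
    qed
  next
    fix w assume "w \<in> act ` perms (Suc n)"
    then obtain \<pi> where \<pi>: "\<pi> permutes {..<Suc n}" "w = act \<pi>" by blast
    have "act \<pi> \<in> generate ?G (root_reflection ` roots)"
      using \<pi>(1) finite_lessThan
    proof (induction rule: permutes_induct)
      case id
      show ?case using generate.one[of ?G] unfolding act_id one .
    next
      case (swap a b p)
      have ab: "a < Suc n" "b < Suc n" using swap by auto
      have "u a - u b \<in> roots" using ab swap by (auto simp: roots_def)
      then have "act (Transposition.transpose a b) \<in> generate ?G (root_reflection ` roots)"
        using ab swap by (intro generate.incl) (metis image_eqI reflection_eq_act)
      from generate.eng[OF this swap.IH]
      show ?case
        by (simp only: mult[OF act_inv(1)[OF tr[OF ab]] act_inv(1)[OF swap.hyps(4)]] act_comp[OF swap.hyps(4)])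
    qed
    then show "w \<in> generate ?G (root_reflection ` roots)" using \<pi> by simp
  qed
qed

lemma root_diff_eq_iff:
  assumes "i < Suc n" "j < Suc n" "k < Suc n" "l < Suc n" "i \<noteq> j"
  shows "u i - u j = u k - u l \<longleftrightarrow> i = k \<and> j = l"
proof
  assume eq: "u i - u j = u k - u l"
  have "(u i - u j) \<bullet> u i = (u k - u l) \<bullet> u i" "(u i - u j) \<bullet> u j = (u k - u l) \<bullet> u j"
    using eq by simp_all
  then show "i = k \<and> j = l"
    using assms by (auto simp: inner_diff_left orthonormal split: if_splits)
qed simp

lemma simple_root_inj: "inj_on simple_root {..<n}"
  by (rule inj_onI) (simp add: simple_root_def root_diff_eq_iff)

lemma diff_eq_sum_simples: "i \<le> j \<Longrightarrow> u i - u j = (\<Sum>k=i..<j. simple_root k)"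
  by (induction j rule: dec_induct) (simp_all add: simple_root_def algebra_simps)

text \<open>
  For \<open>i < j\<close> the root is a telescoping sum of simple roots. Conversely, the vector \<open>\<delta>\<close> below has
  inner product one with each simple root, so it has a non-negative inner product with each positive
  root, while its inner product with \<open>u i - u j\<close> is \<open>j - i\<close>.
\<close>

lemma pos_roots_iff:
  assumes ij: "i < Suc n" "j < Suc n" "i \<noteq> j"
  shows "u i - u j \<in> pos_roots roots simples \<longleftrightarrow> i < j"
proof
  assume "u i - u j \<in> pos_roots roots simples"
  then obtain c where c: "\<forall>p\<in>simples. 0 \<le> c p" "u i - u j = (\<Sum>p\<in>simples. c p *\<^sub>R p)"
    by (auto simp: pos_roots_def)
  define \<delta> where "\<delta> = (\<Sum>k<Suc n. (- real k) *\<^sub>R u k)"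
  have \<delta>: "u k \<bullet> \<delta> = - real k" if "k < Suc n" for k
  proof -
    have "u k \<bullet> \<delta> = (\<Sum>l<Suc n. if l = k then - real l else 0)"
      unfolding \<delta>_def inner_sum_right using that by (intro sum.cong) (auto simp: orthonormal)
    then show ?thesis using that by (simp del: sum.lessThan_Suc)
  qed
  have "(u i - u j) \<bullet> \<delta> = (\<Sum>p\<in>simples. c p * (p \<bullet> \<delta>))"
    unfolding c(2) by (simp add: inner_sum_left)
  moreover have "p \<bullet> \<delta> = 1" if "p \<in> simples" for p
    using that by (auto simp: simples_def simple_root_def inner_diff_left \<delta>)
  ultimately have "0 \<le> (u i - u j) \<bullet> \<delta>"
    using c(1) by (simp add: sum_nonneg)
  then show "i < j" using ij by (simp add: inner_diff_left \<delta>)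
next
  assume "i < j"
  define c where "c p = (if p \<in> simple_root ` {i..<j} then 1 else 0 :: real)" for p
  have sub: "{i..<j} \<subseteq> {..<n}" using ij by auto
  have "(\<Sum>p\<in>simples. c p *\<^sub>R p) = (\<Sum>p\<in>simple_root ` {i..<j}. p)"
    unfolding simples_def using sub by (intro sum.mono_neutral_cong_right) (auto simp: c_def)
  also have "\<dots> = u i - u j"
    using \<open>i < j\<close> by (simp add: sum.reindex[OF inj_on_subset[OF simple_root_inj sub]] diff_eq_sum_simples)
  finally have "u i - u j = (\<Sum>p\<in>simples. c p *\<^sub>R p)" ..
  moreover have "\<forall>p\<in>simples. 0 \<le> c p" by (simp add: c_def)
  moreover have "u i - u j \<in> roots" using ij by (auto simp: roots_def)
  ultimately show "u i - u j \<in> pos_roots roots simples"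
    unfolding pos_roots_def by blast
qed

lemma act_simple_root: "j < n \<Longrightarrow> act \<pi> (simple_root j) = u (\<pi> j) - u (\<pi> (Suc j))"
  by (simp add: simple_root_def linear_diff[OF linear_act] act_frame)

lemma act_simple_root_pos_iff:
  assumes "\<pi> permutes {..<Suc n}" "j < n"
  shows "act \<pi> (simple_root j) \<in> pos_roots roots simples \<longleftrightarrow> \<pi> j < \<pi> (Suc j)"
proof -
  have "\<pi> j \<noteq> \<pi> (Suc j)" using permutes_inj[OF assms(1)] by (metis injD n_not_Suc_n)
  then show ?thesis using assms by (simp add: act_simple_root pos_roots_iff perms_less)
qed

lemma act_simple_root_eq_iff:
  assumes "\<pi> permutes {..<Suc n}" "j < n" "k < n"
  shows "act \<pi> (simple_root j) = simple_root k \<longleftrightarrow> \<pi> j = k \<and> \<pi> (Suc j) = Suc k"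
proof -
  have "\<pi> j \<noteq> \<pi> (Suc j)" using permutes_inj[OF assms(1)] by (metis injD n_not_Suc_n)
  then show ?thesis using assms
    by (simp add: act_simple_root simple_root_def[of k] root_diff_eq_iff perms_less)
qed

lemma X_set_eq:
  assumes J: "J \<subseteq> {..<n}"
  shows "X_set roots simples (simple_root ` J) = act ` min_reps (Suc n) J"
proof -
  have "act \<pi> ` simple_root ` J \<subseteq> pos_roots roots simples \<longleftrightarrow> (\<forall>j\<in>J. \<pi> j < \<pi> (Suc j))"
    if "\<pi> permutes {..<Suc n}" for \<pi>
    unfolding image_image image_subset_iff
    using act_simple_root_pos_iff[OF that] J by (intro ball_cong) auto
  then show ?thesis unfolding X_set_def refl_group_eq min_reps_def by blast
qed

lemma X2_set_eq:
  assumes "J \<subseteq> {..<n}" "K \<subseteq> {..<n}"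
  shows "X2_set roots simples (simple_root ` J) (simple_root ` K) = act ` double_reps (Suc n) J K"
proof (intro equalityI subsetI)
  fix w assume "w \<in> X2_set roots simples (simple_root ` J) (simple_root ` K)"
  then obtain \<pi> \<sigma> where \<pi>: "\<pi> \<in> min_reps (Suc n) J" "w = inv_into UNIV (act \<pi>)"
      and \<sigma>: "\<sigma> \<in> min_reps (Suc n) K" "w = act \<sigma>"
    by (auto simp: X2_set_def X_set_eq assms)
  have p: "\<pi> permutes {..<Suc n}" "\<sigma> permutes {..<Suc n}" using \<pi> \<sigma> by (auto simp: min_reps_def)
  then have "\<sigma> = inv_into UNIV \<pi>"
    using act_inj[OF p(2) perms_inv(1)[OF p(1)]] \<pi>(2) \<sigma>(2) act_inv(2)[OF p(1)] by simp
  then have "inv_into UNIV \<sigma> \<in> min_reps (Suc n) J" using \<pi>(1) permutes_inv_inv[OF p(1)] by simp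
  then show "w \<in> act ` double_reps (Suc n) J K" using \<sigma> by (simp add: double_reps_def)
next
  fix w assume "w \<in> act ` double_reps (Suc n) J K"
  then obtain \<sigma> where \<sigma>: "\<sigma> \<in> min_reps (Suc n) K" "inv_into UNIV \<sigma> \<in> min_reps (Suc n) J" "w = act \<sigma>"
    by (auto simp: double_reps_def)
  have p: "\<sigma> permutes {..<Suc n}" using \<sigma> by (auto simp: min_reps_def)
  have "w = inv_into UNIV (act (inv_into UNIV \<sigma>))"
    using act_inv(2)[OF perms_inv(1)[OF p]] permutes_inv_inv[OF p] \<sigma>(3) by simp
  then have "w \<in> inv_into UNIV ` act ` min_reps (Suc n) J" using \<sigma>(2) by blast
  then show "w \<in> X2_set roots simples (simple_root ` J) (simple_root ` K)"
    using \<sigma> by (simp add: X2_set_def X_set_eq assms)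
qed

lemma meet_steps_eq:
  assumes J: "J \<subseteq> {..<n}" and K: "K \<subseteq> {..<n}" and \<pi>: "\<pi> permutes {..<Suc n}"
  shows "inv_into UNIV (act \<pi>) ` simple_root ` J \<inter> simple_root ` K = simple_root ` meet_steps J K \<pi>"
proof -
  have *: "simple_root k = inv_into UNIV (act \<pi>) (simple_root j) \<longleftrightarrow> \<pi> k = j \<and> \<pi> (Suc k) = Suc j"
    if "j < n" "k < n" for j k
    using act_simple_root_eq_iff[OF \<pi> that(2,1)] act_inv(1)[OF \<pi>]
    by (metis bij_inv_eq_iff)
  have "simple_root k \<in> inv_into UNIV (act \<pi>) ` simple_root ` J \<longleftrightarrow> k \<in> meet_steps J K \<pi>"
    if "k \<in> K" for k
    using that J K * by (force simp: meet_steps_def image_iff subset_iff)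
  then have "{k \<in> K. simple_root k \<in> inv_into UNIV (act \<pi>) ` simple_root ` J} = meet_steps J K \<pi>"
    by (auto simp: meet_steps_def)
  moreover have "A \<inter> simple_root ` K = simple_root ` {k \<in> K. simple_root k \<in> A}" for A
    by auto
  ultimately show ?thesis by simp
qed

lemma meet_steps_subset: "meet_steps J K \<pi> \<subseteq> K"
  by (auto simp: meet_steps_def)

lemma simple_root_image_eq_iff:
  assumes "J \<subseteq> {..<n}" "K \<subseteq> {..<n}"
  shows "simple_root ` J = simple_root ` K \<longleftrightarrow> J = K"
  using inj_on_image_eq_iff[OF simple_root_inj assms] .

lemma a_coeff_eq:
  assumes J: "J \<subseteq> {..<n}" and K: "K \<subseteq> {..<n}" and L: "L \<subseteq> K"
  shows "a_coeff roots simples (simple_root ` J) (simple_root ` K) (simple_root ` L) =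
    card {\<pi> \<in> double_reps (Suc n) J K. meet_steps J K \<pi> = L}"
proof -
  have p: "\<pi> permutes {..<Suc n}" if "\<pi> \<in> double_reps (Suc n) J K" for \<pi>
    using that by (simp add: double_reps_def min_reps_def)
  have "{w \<in> act ` double_reps (Suc n) J K.
        inv_into UNIV w ` simple_root ` J \<inter> simple_root ` K = simple_root ` L} =
      act ` {\<pi> \<in> double_reps (Suc n) J K. meet_steps J K \<pi> = L}"
  proof -
    have "inv_into UNIV (act \<pi>) ` simple_root ` J \<inter> simple_root ` K = simple_root ` L \<longleftrightarrow>
        meet_steps J K \<pi> = L" if "\<pi> \<in> double_reps (Suc n) J K" for \<pi>
      unfolding meet_steps_eq[OF J K p[OF that]]
      using K L meet_steps_subset by (intro simple_root_image_eq_iff) (meson order_trans)+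
    then show ?thesis by blast
  qed
  moreover have "inj_on act {\<pi> \<in> double_reps (Suc n) J K. meet_steps J K \<pi> = L}"
    by (rule inj_onI) (use act_inj p in blast)
  ultimately show ?thesis
    by (simp add: a_coeff_def X2_set_eq[OF J K] card_image)
qed

lemma W_equiv_iff:
  assumes J: "J \<subseteq> {..<n}" and K: "K \<subseteq> {..<n}"
  shows "W_equiv roots (simple_root ` J) (simple_root ` K) \<longleftrightarrow> step_conj (Suc n) J K"
proof -
  have "act \<pi> ` simple_root ` J = simple_root ` K \<longleftrightarrow> \<pi> ` J = K \<and> (\<forall>j\<in>J. \<pi> (Suc j) = Suc (\<pi> j))"
    if \<pi>: "\<pi> permutes {..<Suc n}" for \<pi>
  proof
    assume L: "act \<pi> ` simple_root ` J = simple_root ` K"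
    have step: "\<pi> j \<in> K \<and> \<pi> (Suc j) = Suc (\<pi> j)" if j: "j \<in> J" for j
    proof -
      obtain k where k: "k \<in> K" "act \<pi> (simple_root j) = simple_root k" using L j by blast
      have "j < n" "k < n" using j k J K by auto
      then show ?thesis using act_simple_root_eq_iff[OF \<pi>, of j k] k by simp
    qed
    moreover have "\<exists>j\<in>J. \<pi> j = k" if k: "k \<in> K" for k
    proof -
      have "simple_root k \<in> act \<pi> ` simple_root ` J" using L k by blast
      then obtain j where j: "j \<in> J" "act \<pi> (simple_root j) = simple_root k" by auto
      have "j < n" "k < n" using j k J K by auto
      then show ?thesis using act_simple_root_eq_iff[OF \<pi>, of j k] j by auto
    qed
    ultimately show "\<pi> ` J = K \<and> (\<forall>j\<in>J. \<pi> (Suc j) = Suc (\<pi> j))" by blast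
  next
    assume R: "\<pi> ` J = K \<and> (\<forall>j\<in>J. \<pi> (Suc j) = Suc (\<pi> j))"
    have "act \<pi> (simple_root j) = simple_root (\<pi> j)" if "j \<in> J" for j
      using act_simple_root[of j \<pi>] R that J by (auto simp: simple_root_def)
    then have "act \<pi> ` simple_root ` J = simple_root ` \<pi> ` J" by (simp add: image_image cong: image_cong)
    then show "act \<pi> ` simple_root ` J = simple_root ` K" using R by simp
  qed
  then show ?thesis by (simp add: W_equiv_def refl_group_eq step_conj_def cong: conj_cong)
qed


section \<open>Conjugacy classes of step sets\<close>

text \<open>
  The set \<open>X\<^sub>J\<close> determines \<open>J\<close>: the simple reflection in the root with index \<open>i\<close> belongs to \<open>X\<^sub>J\<close> if and
  only if \<open>i \<notin> J\<close>, as it maps this root to its negative and the other simple roots to positive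
  roots.
\<close>

lemma X_set_inj:
  assumes J: "J \<subseteq> {..<n}" and K: "K \<subseteq> {..<n}"
    and eq: "X_set roots simples (simple_root ` J) = X_set roots simples (simple_root ` K)"
  shows "J = K"
proof -
  have swap: "act (Transposition.transpose i (Suc i)) \<in> X_set roots simples (simple_root ` L) \<longleftrightarrow> i \<notin> L"
    if i: "i < n" and L: "L \<subseteq> {..<n}" for i L
  proof -
    let ?t = "Transposition.transpose i (Suc i)"
    have t: "?t permutes {..<Suc n}" using i by (simp add: permutes_swap_id)
    have "act ?t \<in> X_set roots simples (simple_root ` L) \<longleftrightarrow> ?t \<in> min_reps (Suc n) L"
      unfolding X_set_eq[OF L] using act_inj t by (auto simp: min_reps_def)
    also have "\<dots> \<longleftrightarrow> i \<notin> L"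
      using t by (auto simp: min_reps_def Transposition.transpose_def)
    finally show ?thesis .
  qed
  have "i \<in> J \<longleftrightarrow> i \<in> K" if "i < n" for i
    using swap[OF that J] swap[OF that K] eq by simp
  then show ?thesis using J K by blast
qed

definition cls :: "nat set \<Rightarrow> (('a \<Rightarrow> 'a) \<Rightarrow>\<^sub>0 rat) set" where
  "cls J = x_class roots simples (simple_root ` J)"

definition conj_classes :: "(('a \<Rightarrow> 'a) \<Rightarrow>\<^sub>0 rat) set set" where
  "conj_classes = cls ` Pow {..<n}"

lemma subset_simples_iff: "A \<subseteq> simples \<longleftrightarrow> (\<exists>J\<subseteq>{..<n}. A = simple_root ` J)"
  unfolding simples_def by (auto simp: subset_image_iff)

lemma conj_classes_eq: "conj_classes = x_class roots simples ` Pow simples"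
  unfolding conj_classes_def simples_def image_Pow_surj[OF refl, symmetric] cls_def by (simp add: image_image)

lemma step_conj_refl: "step_conj N J J"
  unfolding step_conj_def by (intro exI[of _ id]) (simp add: permutes_id)

lemma step_conj_trans:
  assumes "step_conj N J K" "step_conj N K L"
  shows "step_conj N J L"
proof -
  obtain \<pi> \<sigma> where "\<pi> permutes {..<N}" "\<pi> ` J = K" "\<forall>j\<in>J. \<pi> (Suc j) = Suc (\<pi> j)"
      and "\<sigma> permutes {..<N}" "\<sigma> ` K = L" "\<forall>k\<in>K. \<sigma> (Suc k) = Suc (\<sigma> k)"
    using assms unfolding step_conj_def by blast
  then show ?thesis unfolding step_conj_def
    by (intro exI[of _ "\<sigma> \<circ> \<pi>"]) (auto simp: permutes_compose)
qed

lemma x_elem_inj: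
  assumes J: "J \<subseteq> {..<n}" and K: "K \<subseteq> {..<n}"
    and eq: "x_elem roots simples (simple_root ` J) = x_elem roots simples (simple_root ` K)"
  shows "J = K"
proof (rule X_set_inj[OF J K])
  have "w \<in> X_set roots simples (simple_root ` L) \<longleftrightarrow>
      Poly_Mapping.lookup (x_elem roots simples (simple_root ` L)) w \<noteq> 0" if L: "L \<subseteq> {..<n}" for L w
  proof -
    have "finite (X_set roots simples (simple_root ` L))"
      unfolding X_set_eq[OF L] by (rule finite_imageI, rule finite_subset[OF _ finite_perms[of "Suc n"]])
        (auto simp: min_reps_def)
    then show ?thesis
      by (simp add: x_elem_def lookup_sum lookup_single when_def sum.delta)
  qed
  then show "X_set roots simples (simple_root ` J) = X_set roots simples (simple_root ` K)"
    using J K eq by auto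
qed

lemma cls_eq_iff:
  assumes J: "J \<subseteq> {..<n}" and K: "K \<subseteq> {..<n}"
  shows "cls J = cls K \<longleftrightarrow> step_conj (Suc n) J K"
proof -
  have cls: "cls J = {x_elem roots simples (simple_root ` L) | L. L \<subseteq> {..<n} \<and> step_conj (Suc n) L J}"
    if "J \<subseteq> {..<n}" for J
    unfolding cls_def x_class_def using that W_equiv_iff by (auto simp: subset_simples_iff)
  show ?thesis
  proof
    assume "cls J = cls K"
    moreover have "x_elem roots simples (simple_root ` J) \<in> cls J"
      using cls[OF J] J step_conj_refl by blast
    ultimately obtain L where "L \<subseteq> {..<n}" "step_conj (Suc n) L K"
        "x_elem roots simples (simple_root ` J) = x_elem roots simples (simple_root ` L)"
      using cls[OF K] by auto
    then show "step_conj (Suc n) J K" using x_elem_inj[OF J] by blast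
  next
    assume "step_conj (Suc n) J K"
    then have "step_conj (Suc n) L J \<longleftrightarrow> step_conj (Suc n) L K" for L
      using step_conj_trans step_conj_sym by blast
    then show "cls J = cls K" using cls[OF J] cls[OF K] by simp
  qed
qed

section \<open>Characters of the algebra\<close>

definition rep :: "(('a \<Rightarrow> 'a) \<Rightarrow>\<^sub>0 rat) set \<Rightarrow> nat set" where
  "rep C = (SOME J. J \<subseteq> {..<n} \<and> cls J = C)"

definition class_mark :: "nat set \<Rightarrow> (('a \<Rightarrow> 'a) \<Rightarrow>\<^sub>0 rat) set \<Rightarrow> rat" where
  "class_mark M C = of_nat (mark (Suc n) M (block_index (rep C)))"

definition mark_char :: "nat set \<Rightarrow> 'a descent_elem \<Rightarrow> rat" where
  "mark_char M f = (\<Sum>C\<in>conj_classes. Poly_Mapping.lookup f C * class_mark M C)"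

lemma steps_eq: "{i. Suc i < Suc n} = {..<n}" by auto

lemma rep: "C \<in> conj_classes \<Longrightarrow> rep C \<subseteq> {..<n} \<and> cls (rep C) = C"
  unfolding rep_def by (rule someI_ex) (auto simp: conj_classes_def)

lemma finite_conj_classes: "finite conj_classes" by (simp add: conj_classes_def)

text \<open>
  By \<open>mark_conj\<close> the mark does not depend on the representative chosen by \<open>rep\<close>.
\<close>

lemma class_mark_cls:
  assumes J: "J \<subseteq> {..<n}" and M: "M \<subseteq> {..<n}"
  shows "class_mark M (cls J) = of_nat (mark (Suc n) M (block_index J))"
proof -
  have "cls J \<in> conj_classes" using J by (simp add: conj_classes_def)
  then have "rep (cls J) \<subseteq> {..<n}" "cls (rep (cls J)) = cls J" using rep by auto
  then have "step_conj (Suc n) (rep (cls J)) J" using J cls_eq_iff by blast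
  then show ?thesis using mark_conj[of "Suc n" "rep (cls J)" J M, unfolded steps_eq] M
    by (simp add: class_mark_def)
qed

lemma lookup_rat_scale: "Poly_Mapping.lookup (rat_scale q f) x = q * Poly_Mapping.lookup f x"
  by (auto simp: rat_scale_def Poly_Mapping.map.rep_eq when_def)

lemma keys_rat_scale: "Poly_Mapping.keys (rat_scale q f) \<subseteq> Poly_Mapping.keys f"
  by (auto simp: in_keys_iff lookup_rat_scale)

lemma mark_char_add: "mark_char M (f + g) = mark_char M f + mark_char M g"
  by (simp add: mark_char_def lookup_add algebra_simps sum.distrib)

lemma mark_char_zero: "mark_char M 0 = 0"
  by (simp add: mark_char_def)

lemma mark_char_sum: "mark_char M (sum f A) = (\<Sum>x\<in>A. mark_char M (f x))"
  by (induction A rule: infinite_finite_induct) (simp_all add: mark_char_add mark_char_zero)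

lemma mark_char_scale: "mark_char M (rat_scale q f) = q * mark_char M f"
  by (simp add: mark_char_def lookup_rat_scale sum_distrib_left mult.assoc)

lemma mark_char_single: "C \<in> conj_classes \<Longrightarrow> mark_char M (Poly_Mapping.single C q) = q * class_mark M C"
proof -
  assume C: "C \<in> conj_classes"
  have "mark_char M (Poly_Mapping.single C q) = (\<Sum>D\<in>conj_classes. if D = C then q * class_mark M C else 0)"
    unfolding mark_char_def by (intro sum.cong) (auto simp: lookup_single when_def)
  then show ?thesis using C finite_conj_classes by simp
qed

lemma mark_char_alt:
  assumes "Poly_Mapping.keys f \<subseteq> conj_classes"
  shows "mark_char M f = (\<Sum>C\<in>Poly_Mapping.keys f. Poly_Mapping.lookup f C * class_mark M C)"
  unfolding mark_char_def using assms finite_conj_classes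
  by (intro sum.mono_neutral_right) (auto simp: in_keys_iff)

lemma class_mark_triangular:
  assumes "C \<in> conj_classes" "D \<in> conj_classes" "C \<noteq> D" "class_mark (rep C) D \<noteq> 0"
  shows "card (rep C) < card (rep D)"
proof -
  have "card (rep C) < card (rep D) \<or> step_conj (Suc n) (rep D) (rep C)"
    using assms rep by (intro mark_triangular) (auto simp: class_mark_def)
  moreover have "\<not> step_conj (Suc n) (rep D) (rep C)"
    using cls_eq_iff[of "rep D" "rep C"] rep[OF assms(1)] rep[OF assms(2)] assms(3) by auto
  ultimately show ?thesis by blast
qed

lemma class_mark_diag: "class_mark (rep C) C \<noteq> 0"
  by (simp add: class_mark_def mark_self)

lemma mark_chars_separate:
  assumes f: "Poly_Mapping.keys f \<subseteq> conj_classes" and zero: "\<And>C. C \<in> conj_classes \<Longrightarrow> mark_char (rep C) f = 0"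
  shows "f = 0"
proof (rule poly_mapping_eqI)
  fix D
  show "Poly_Mapping.lookup f D = Poly_Mapping.lookup 0 D"
  proof (cases "D \<in> conj_classes")
    case True
    have "Poly_Mapping.lookup f D = 0"
    proof (rule triangular_system_injective[OF finite_conj_classes _ _ _ True,
          where c = "\<lambda>C. class_mark (rep C)" and rk = "\<lambda>C. card (rep C)"])
      show "(\<Sum>D\<in>conj_classes. class_mark (rep C) D * Poly_Mapping.lookup f D) = 0" if "C \<in> conj_classes" for C
        using zero[OF that] by (simp add: mark_char_def mult.commute)
    qed (use class_mark_diag class_mark_triangular in auto)
    then show ?thesis by simp
  next
    case False
    then show ?thesis using f by (auto simp: in_keys_iff)
  qed
qed

definition basis_product :: "nat set \<Rightarrow> nat set \<Rightarrow> 'a descent_elem" where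
  "basis_product J K = (\<Sum>L\<in>Pow (simple_root ` K).
     rat_scale (of_nat (a_coeff roots simples (simple_root ` J) (simple_root ` K) L)) (x_basis roots simples L))"

lemma keys_basis_product:
  assumes "K \<subseteq> {..<n}"
  shows "Poly_Mapping.keys (basis_product J K) \<subseteq> conj_classes"
proof -
  have "Poly_Mapping.keys (rat_scale q (x_basis roots simples L)) \<subseteq> conj_classes" if "L \<subseteq> simple_root ` K" for q L
  proof -
    have "L \<subseteq> simples" using that assms by (auto simp: simples_def)
    then show ?thesis using keys_rat_scale[of q "x_basis roots simples L"]
      by (auto simp: x_basis_def conj_classes_eq)
  qed
  then show ?thesis unfolding basis_product_def
    by (intro order_trans[OF keys_sum] UN_least) auto
qed

text \<open>
  The elements of \<open>X\<^sub>J\<^sub>K\<close> are grouped by the value of \<open>\<pi>\<^sup>-\<^sup>1(J) \<inter> K\<close>; the group belonging to \<open>L\<close> has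
  \<open>a\<^sub>J\<^sub>K\<^sub>L\<close> members. This turns the sum over \<open>L\<close> into the sum in \<open>mark_mult\<close>.
\<close>

lemma mark_char_basis_product:
  assumes J: "J \<subseteq> {..<n}" and K: "K \<subseteq> {..<n}" and M: "M \<subseteq> {..<n}"
  shows "mark_char M (basis_product J K) = class_mark M (cls J) * class_mark M (cls K)"
proof -
  let ?D = "double_reps (Suc n) J K"
  let ?m = "\<lambda>L. mark (Suc n) M (block_index L)"
  have injK: "inj_on ((`) simple_root) (Pow K)"
    using simple_root_image_eq_iff K by (intro inj_onI) (metis Pow_iff order_trans)
  have "mark_char M (basis_product J K) =
      (\<Sum>L\<in>Pow K. of_nat (a_coeff roots simples (simple_root ` J) (simple_root ` K) (simple_root ` L)) *
        mark_char M (x_basis roots simples (simple_root ` L)))"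
    unfolding basis_product_def image_Pow_surj[OF refl, symmetric]
    by (simp add: sum.reindex[OF injK] mark_char_sum mark_char_scale)
  also have "\<dots> = (\<Sum>L\<in>Pow K. of_nat (\<Sum>\<pi>\<in>{\<pi> \<in> ?D. meet_steps J K \<pi> = L}. ?m (meet_steps J K \<pi>)))"
  proof (rule sum.cong)
    fix L assume "L \<in> Pow K"
    then have L: "L \<subseteq> K" "L \<subseteq> {..<n}" using K by auto
    then have "mark_char M (x_basis roots simples (simple_root ` L)) = of_nat (?m L)"
      using mark_char_single[of "cls L" M 1] class_mark_cls[OF L(2) M]
      by (simp add: x_basis_def cls_def conj_classes_def)
    then show "of_nat (a_coeff roots simples (simple_root ` J) (simple_root ` K) (simple_root ` L)) *
        mark_char M (x_basis roots simples (simple_root ` L)) =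
        of_nat (\<Sum>\<pi>\<in>{\<pi> \<in> ?D. meet_steps J K \<pi> = L}. ?m (meet_steps J K \<pi>))"
      by (simp add: a_coeff_eq[OF J K L(1)])
  qed simp
  also have "\<dots> = of_nat (\<Sum>L\<in>Pow K. \<Sum>\<pi>\<in>{\<pi> \<in> ?D. meet_steps J K \<pi> = L}. ?m (meet_steps J K \<pi>))"
    by simp
  also have "(\<Sum>L\<in>Pow K. \<Sum>\<pi>\<in>{\<pi> \<in> ?D. meet_steps J K \<pi> = L}. ?m (meet_steps J K \<pi>)) =
      (\<Sum>\<pi>\<in>?D. ?m (meet_steps J K \<pi>))"
  proof (rule sum.group)
    show "finite ?D"
      by (rule finite_subset[OF _ finite_perms[of "Suc n"]]) (auto simp: double_reps_def min_reps_def)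
    show "finite (Pow K)" using K finite_subset by auto
  qed (use meet_steps_subset in auto)
  also have "\<dots> = ?m J * ?m K"
    using mark_mult[of J "Suc n" K M, unfolded steps_eq, OF J K M] by simp
  finally show ?thesis using class_mark_cls J K M by simp
qed

text \<open>
  The multiplication of classes is well defined: for other representatives of the two classes, all
  marks of the product are unchanged, and marks separate the elements of the algebra.
\<close>

lemma class_mult_eq:
  assumes J: "J \<subseteq> {..<n}" and K: "K \<subseteq> {..<n}"
  shows "class_mult roots simples (cls J) (cls K) = basis_product J K"
proof -
  have wd: "basis_product J' K' = basis_product J K"
    if J': "J' \<subseteq> {..<n}" "cls J' = cls J" and K': "K' \<subseteq> {..<n}" "cls K' = cls K" for J' K'
  proof -
    have "basis_product J' K' - basis_product J K = 0"
    proof (rule mark_chars_separate)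
      show "Poly_Mapping.keys (basis_product J' K' - basis_product J K) \<subseteq> conj_classes"
        using keys_diff[of "basis_product J' K'" "basis_product J K"]
          keys_basis_product[OF K, of J] keys_basis_product[OF K'(1), of J'] by blast
      fix C assume "C \<in> conj_classes"
      then have M: "rep C \<subseteq> {..<n}" using rep by simp
      have "mark_char (rep C) (basis_product J' K') = mark_char (rep C) (basis_product J K)"
        using mark_char_basis_product M J K J' K' by simp
      then show "mark_char (rep C) (basis_product J' K' - basis_product J K) = 0"
        using mark_char_add[of "rep C" "basis_product J' K' - basis_product J K" "basis_product J K"] by simp
    qed
    then show ?thesis by simp
  qed
  let ?z = "\<lambda>J K. \<Sum>L\<in>Pow K. rat_scale (of_nat (a_coeff roots simples J K L)) (x_basis roots simples L)"
  show ?thesis unfolding class_mult_def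
  proof (rule the_equality)
    have "basis_product J K = ?z A B"
      if A: "A \<subseteq> simples" "x_class roots simples A = cls J"
        and B: "B \<subseteq> simples" "x_class roots simples B = cls K" for A B
    proof -
      obtain J' K' where J': "J' \<subseteq> {..<n}" "A = simple_root ` J'" and K': "K' \<subseteq> {..<n}" "B = simple_root ` K'"
        using A(1) B(1) unfolding subset_simples_iff by blast
      have "basis_product J' K' = basis_product J K"
        using A(2) B(2) unfolding J'(2) K'(2) cls_def[symmetric] by (intro wd J'(1) K'(1))
      then show ?thesis unfolding J'(2) K'(2) by (simp only: basis_product_def)
    qed
    then show "\<forall>A B. A \<subseteq> simples \<and> B \<subseteq> simples \<and> x_class roots simples A = cls J \<and>
        x_class roots simples B = cls K \<longrightarrow> basis_product J K = ?z A B"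
      by blast
    fix z assume "\<forall>A B. A \<subseteq> simples \<and> B \<subseteq> simples \<and> x_class roots simples A = cls J \<and>
        x_class roots simples B = cls K \<longrightarrow> z = ?z A B"
    moreover have "simple_root ` J \<subseteq> simples" "simple_root ` K \<subseteq> simples"
      using J K by (auto simp: simples_def)
    ultimately show "z = basis_product J K"
      unfolding basis_product_def cls_def by blast
  qed
qed

lemma keys_class_mult:
  assumes "C \<in> conj_classes" "D \<in> conj_classes"
  shows "Poly_Mapping.keys (class_mult roots simples C D) \<subseteq> conj_classes"
proof -
  obtain J K where "J \<subseteq> {..<n}" "K \<subseteq> {..<n}" "C = cls J" "D = cls K"
    using assms by (auto simp: conj_classes_def)
  then show ?thesis using keys_basis_product class_mult_eq by simp
qed

lemma mark_char_class_mult: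
  assumes "C \<in> conj_classes" "D \<in> conj_classes" "M \<subseteq> {..<n}"
  shows "mark_char M (class_mult roots simples C D) = class_mark M C * class_mark M D"
proof -
  obtain J K where "J \<subseteq> {..<n}" "K \<subseteq> {..<n}" "C = cls J" "D = cls K"
    using assms by (auto simp: conj_classes_def)
  then show ?thesis using mark_char_basis_product assms(3) class_mult_eq by simp
qed

lemma keys_descent_mult:
  assumes "Poly_Mapping.keys f \<subseteq> conj_classes" "Poly_Mapping.keys g \<subseteq> conj_classes"
  shows "Poly_Mapping.keys (descent_mult roots simples f g) \<subseteq> conj_classes"
  unfolding descent_mult_def
  by (intro order_trans[OF keys_sum] UN_least order_trans[OF keys_rat_scale] keys_class_mult)
    (use assms in auto)

lemma mark_char_descent_mult:
  assumes f: "Poly_Mapping.keys f \<subseteq> conj_classes" and g: "Poly_Mapping.keys g \<subseteq> conj_classes" and M: "M \<subseteq> {..<n}"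
  shows "mark_char M (descent_mult roots simples f g) = mark_char M f * mark_char M g"
proof -
  have "mark_char M (descent_mult roots simples f g) =
      (\<Sum>C\<in>Poly_Mapping.keys f. \<Sum>D\<in>Poly_Mapping.keys g.
        (Poly_Mapping.lookup f C * class_mark M C) * (Poly_Mapping.lookup g D * class_mark M D))"
    unfolding descent_mult_def mark_char_sum mark_char_scale
  proof (intro sum.cong refl)
    fix C D assume "C \<in> Poly_Mapping.keys f" "D \<in> Poly_Mapping.keys g"
    then have "mark_char M (class_mult roots simples C D) = class_mark M C * class_mark M D"
      using f g M by (intro mark_char_class_mult) auto
    then show "Poly_Mapping.lookup f C * Poly_Mapping.lookup g D * mark_char M (class_mult roots simples C D) =
        (Poly_Mapping.lookup f C * class_mark M C) * (Poly_Mapping.lookup g D * class_mark M D)"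
      by simp
  qed
  then show ?thesis by (simp add: mark_char_alt[OF f] mark_char_alt[OF g] sum_product)
qed

text \<open>
  The full step set has a single block, so its block sequence is constant and has no other
  rearrangement.
\<close>

lemma mark_char_one:
  assumes "M \<subseteq> {..<n}"
  shows "mark_char M (x_basis roots simples simples) = 1"
proof -
  let ?h = "block_index {..<n}"
  have h: "?h i = 0" if "i < Suc n" for i
    using that by (induction i) auto
  have "?h \<circ> \<pi> = ?h" if \<pi>: "\<pi> permutes {..<Suc n}" for \<pi>
  proof
    fix i
    show "(?h \<circ> \<pi>) i = ?h i"
      using h[of i] h[of "\<pi> i"] perms_less[OF \<pi>, of i] permutes_not_in[OF \<pi>, of i] by (cases "i < Suc n") auto
  qed
  then have "rearrangements (Suc n) ?h = {?h}"
    using rearrangement_self[of ?h "Suc n"] by (auto simp: rearrangements_def)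
  moreover have "const_on_steps M ?h" using assms by (auto simp: const_on_steps_def)
  ultimately have "{f \<in> rearrangements (Suc n) ?h. const_on_steps M f} = {?h}" by auto
  then have "mark (Suc n) M ?h = 1" by (simp add: mark_def)
  then show ?thesis
    using mark_char_single[of "cls {..<n}" M 1] class_mark_cls[OF subset_refl assms]
    by (simp add: x_basis_def simples_def cls_def conj_classes_def)
qed

theorem new_descent_algebra_semisimple:
  "semisimple_algebra (ring_of_type_algebra :: rat ring) (new_descent_algebra roots simples)"
proof -
  have "\<exists>\<epsilon>. Poly_Mapping.keys \<epsilon> \<subseteq> conj_classes \<and>
      (\<forall>D\<in>conj_classes. mark_char (rep D) \<epsilon> = (if C = D then 1 else 0))" for C
  proof -
    have "\<exists>f. \<forall>D\<in>conj_classes.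
        (\<Sum>E\<in>conj_classes. class_mark (rep D) E * f E) = (if C = D then 1 else 0)"
      by (rule triangular_system_solvable[where rk = "\<lambda>D. card (rep D)",
          OF finite_conj_classes class_mark_diag class_mark_triangular])
    then obtain f where f: "\<And>D. D \<in> conj_classes \<Longrightarrow>
        (\<Sum>E\<in>conj_classes. class_mark (rep D) E * f E) = (if C = D then 1 else 0)"
      by blast
    \<comment> \<open>The coefficients of the dual elements solve the triangular system given by the table of marks.\<close>
    define \<epsilon> where "\<epsilon> = (\<Sum>E\<in>conj_classes. Poly_Mapping.single E (f E))"
    have "Poly_Mapping.keys \<epsilon> \<subseteq> conj_classes"
      unfolding \<epsilon>_def by (rule order_trans[OF keys_sum]) auto
    moreover have "mark_char (rep D) \<epsilon> = (if C = D then 1 else 0)" if "D \<in> conj_classes" for D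
      using f[OF that] by (simp add: \<epsilon>_def mark_char_sum mark_char_single mult.commute)
    ultimately show ?thesis by blast
  qed
  then have "\<exists>\<epsilon>. \<forall>C. Poly_Mapping.keys (\<epsilon> C) \<subseteq> conj_classes \<and>
      (\<forall>D\<in>conj_classes. mark_char (rep D) (\<epsilon> C) = (if C = D then 1 else 0))"
    by (intro choice) blast
  then obtain \<epsilon> where \<epsilon>: "\<And>C. Poly_Mapping.keys (\<epsilon> C) \<subseteq> conj_classes"
      "\<And>C D. D \<in> conj_classes \<Longrightarrow> mark_char (rep D) (\<epsilon> C) = (if C = D then 1 else 0)"
    by blast
  have carrier: "carrier (new_descent_algebra roots simples) = {f. Poly_Mapping.keys f \<subseteq> conj_classes}"
    by (simp add: new_descent_algebra_def conj_classes_eq)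
  have one: "Poly_Mapping.keys (x_basis roots simples simples) \<subseteq> conj_classes"
    by (simp add: x_basis_def conj_classes_eq)
  have repD: "rep C \<subseteq> {..<n}" if "C \<in> conj_classes" for C using rep that by simp
  show ?thesis
  proof (rule semisimple_of_dual_characters[where S = conj_classes and ch = "\<lambda>C. mark_char (rep C)" and \<epsilon> = \<epsilon>],
      unfold carrier mem_Collect_eq)
    show "x = 0" if "Poly_Mapping.keys x \<subseteq> conj_classes" "\<And>i. i \<in> conj_classes \<Longrightarrow> mark_char (rep i) x = 0" for x
      using mark_chars_separate that by blast
    show "Poly_Mapping.keys (x + y) \<subseteq> conj_classes"
      if "Poly_Mapping.keys x \<subseteq> conj_classes" "Poly_Mapping.keys y \<subseteq> conj_classes"
      for x y :: "'a descent_elem"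
      using Poly_Mapping.keys_add[of x y] that by blast
    show "Poly_Mapping.keys (q \<odot>\<^bsub>new_descent_algebra roots simples\<^esub> x) \<subseteq> conj_classes"
      if "Poly_Mapping.keys x \<subseteq> conj_classes" for q x
      using keys_rat_scale[of q x] that by (simp add: new_descent_algebra_def)
  qed (simp_all add: new_descent_algebra_def finite_conj_classes \<epsilon> one mark_char_add mark_char_scale
      mark_char_descent_mult keys_descent_mult mark_char_one repD)
qed

end

theorem corollary2p6:
  fixes n :: nat and e :: "nat \<Rightarrow> 'a::euclidean_space"
  assumes "n \<ge> 1"
    and "DIM('a) = n + 1"
    and "\<And>i j. i \<in> {1..n+1} \<Longrightarrow> j \<in> {1..n+1} \<Longrightarrow> e i \<bullet> e j = (if i = j then 1 else 0)"
  shows "semisimple_algebra (ring_of_type_algebra :: rat ring)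
           (new_descent_algebra (A_roots n e) (A_simple n e))"
proof -
  interpret orthonormal_frame n "\<lambda>i. e (Suc i)"
    by standard (use assms(2,3) in auto)
  have shift: "{1..n+1} = Suc ` {..<Suc n}" "{1..n} = Suc ` {..<n}"
    by (auto simp: image_iff Suc_le_eq gr0_conv_Suc less_Suc_eq_le)
  have "A_roots n e = roots"
    unfolding A_roots_def roots_def shift by blast
  moreover have "A_simple n e = simples"
    unfolding A_simple_def simples_def simple_root_def shift by auto
  ultimately show ?thesis using new_descent_algebra_semisimple by simp
qed

end
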